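(* Let $M:[0,\infty)\to[0,\infty)$ be a differentiable $N$-function and let $D_M\ge d_M\ge 1$ be constants with $d_M\frac{M(\lambda)}{\lambda}\le M'(\lambda)\le D_M\frac{M(\lambda)}{\lambda}$ for every $\lambda>0$. Let $\varphi\in C^2(\mathbb{R}_+)$ be such that $\varphi'$ never vanishes, and let $\omega:(0,\infty)\to[0,\infty)$ be a $C^1$ function. Assume that $A_\varphi(r)$ is well defined (finite) for all small $r>0$ and that the function $$K(r)=\frac{M(\omega(r)A_\varphi(r))}{|\varphi'(r)|}e^{-\varphi(r)}$$ is bounded near $0$. Assume moreover that either ($\varphi'>0$, $b_1>0$ and $L<\infty$) or ($\varphi'<0$, $b_2>0$ and $L<\infty$). Then: (i) There exists a constant $C>0$ such that $$\int_0^\infty M(\omega(x)|u(x)|)e^{-\varphi(x)}dx\le C\int_0^\infty M(|u'(x)|)e^{-\varphi(x)}dx$$ holds for every $u\in\mathcal{H}$. (ii) There is a constant $B>0$ such that, with $G(\epsilon,y)=\int_y^\infty M(\epsilon\,\omega(x))e^{-\varphi(x)}dx$, $$\int_0^yM^*\left(\frac{G(\epsilon,y)}{B\,\epsilon\,e^{-\varphi(x)}}\right)e^{-\varphi(x)}dx\le G(\epsilon,y)<\infty$$ for all $y>0$ and $\epsilon>0$.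
   Context: $\mathbb{R}_+=(0,\infty)$. Functions in $W^{1,1}_{loc}(\mathbb{R}_+)$ are identified with their locally absolutely continuous representatives. An $N$-function is a continuous convex function $M:[0,\infty)\to[0,\infty)$ with $M(\lambda)/\lambda\to0$ as $\lambda\to0$ and $M(\lambda)/\lambda\to\infty$ as $\lambda\to\infty$. Its complementary function is $M^*(y)=\sup_{x>0}[xy-M(x)]$, $y\ge0$. $\mathcal{H}=\{u\in W^{1,1}_{loc}(\mathbb{R}_+):\lim_{r\to0}u(r)=0\}$ (the set of Hardy transforms). Let $c(x)=\max(x^{d_M},x^{D_M})$ for $x\ge0$, with inverse $c^{-1}$, and $f_\varphi(r)=c^{-1}(e^{-\varphi(r)})$. Put $A_\varphi(r)=\|1/f_\varphi\|_{L^{(M^* )}(0,r)}$, where the dual norm (with respect to Lebesgue measure) is $\|w\|_{L^{(M^* )}(0,r)}=\sup\{\int_0^rw(x)v(x)\,dx:\ v\in L^M(0,r),\ \int_0^rM(|v(x)|)\,dx\le1\}$. Let $F=\{r\in\mathbb{R}_+:\omega(r)\ne0,\ \omega'(r)\varphi'(r)>0\}$ and $G_0=\{r\in\mathbb{R}_+:\omega(r)\neq0,\ \omega'(r)\varphi'(r)<0\}$, with $\chi_A$ the indicator function of $A$ (an expression $f\chi_A$ is taken to be $0$ outside $A$). Define $$b_1=\inf_{r>0}\left(1+\frac{\varphi''(r)}{(\varphi'(r))^2}-\frac{\omega'(r)}{\omega(r)\varphi'(r)}\left[d_M\chi_{G_0}(r)+D_M\chi_F(r)\right]\right),$$ $$b_2=\inf_{r>0}\left(-1-\frac{\varphi''(r)}{(\varphi'(r))^2}+\frac{\omega'(r)}{\omega(r)\varphi'(r)}\left[d_M\chi_F(r)+D_M\chi_{G_0}(r)\right]\right),\qquad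 L=\sup_{r>0}\frac{\omega(r)}{|\varphi'(r)|}.$$ *)

theory Defs
  imports "HOL-Analysis.Analysis"
begin

text \<open>The half-line is \<open>{0<..} :: real set\<close>. Functions on it, or on \<open>{0..}\<close>, are total functions
  on the reals whose values elsewhere are irrelevant.\<close>

definition N_function :: "(real \<Rightarrow> real) \<Rightarrow> bool" where
  "N_function M \<longleftrightarrow>
     (\<forall>x\<ge>0. 0 \<le> M x) \<and> continuous_on {0..} M \<and> convex_on {0..} M \<and>
     ((\<lambda>x. M x / x) \<longlongrightarrow> 0) (at_right 0) \<and> filterlim (\<lambda>x. M x / x) at_top at_top"

text \<open>For an N-function the supremum below is that of a set bounded above, since \<open>M x / x\<close> tends
  to infinity; the real-valued \<open>SUP\<close> is therefore the true supremum.\<close>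

definition complementary :: "(real \<Rightarrow> real) \<Rightarrow> real \<Rightarrow> real" where
  "complementary M y = (SUP x\<in>{0<..}. x * y - M x)"

definition modular :: "(real \<Rightarrow> real) \<Rightarrow> real set \<Rightarrow> (real \<Rightarrow> real) \<Rightarrow> ennreal" where
  "modular M S v = (\<integral>\<^sup>+x. ennreal (M \<bar>v x\<bar>) \<partial>lebesgue_on S)"

definition orlicz_space :: "(real \<Rightarrow> real) \<Rightarrow> real set \<Rightarrow> (real \<Rightarrow> real) set" where
  "orlicz_space M S =
     {v \<in> borel_measurable (lebesgue_on S). \<exists>l>0. modular M S (\<lambda>x. v x / l) < \<infinity>}"

text \<open>The Lebesgue integral with values in the extended reals, used so that a pairing \<open>\<integral> w v\<close> that
  diverges makes the dual norm infinite (the Bochner integral would return 0). When positive and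
  negative part both have infinite integral, \<open>\<infinity> - \<infinity> = \<infinity>\<close> in \<open>ereal\<close>; this does not affect
  the dual norm, because then \<open>v\<close> restricted to \<open>{x. w x * v x > 0}\<close> is also an admissible test
  function, with a pairing that is unambiguously \<open>\<infinity>\<close>.\<close>

definition ext_integral :: "real set \<Rightarrow> (real \<Rightarrow> real) \<Rightarrow> ereal" where
  "ext_integral S h =
     enn2ereal (\<integral>\<^sup>+x. ennreal (h x) \<partial>lebesgue_on S) -
     enn2ereal (\<integral>\<^sup>+x. ennreal (- h x) \<partial>lebesgue_on S)"

definition dual_norm :: "(real \<Rightarrow> real) \<Rightarrow> real \<Rightarrow> (real \<Rightarrow> real) \<Rightarrow> ereal" where
  "dual_norm M r w =
     (SUP v\<in>{v \<in> orlicz_space M {0<..<r}. modular M {0<..<r} v \<le> 1}.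
        ext_integral {0<..<r} (\<lambda>x. w x * v x))"

definition c_fun :: "real \<Rightarrow> real \<Rightarrow> real \<Rightarrow> real" where
  "c_fun d D x = max (x powr d) (x powr D)"

definition f_phi :: "real \<Rightarrow> real \<Rightarrow> (real \<Rightarrow> real) \<Rightarrow> real \<Rightarrow> real" where
  "f_phi d D \<phi> r = inv_into {0..} (c_fun d D) (exp (- \<phi> r))"

definition A_phi ::
  "(real \<Rightarrow> real) \<Rightarrow> real \<Rightarrow> real \<Rightarrow> (real \<Rightarrow> real) \<Rightarrow> real \<Rightarrow> ereal" where
  "A_phi M d D \<phi> r = dual_norm M r (\<lambda>x. 1 / f_phi d D \<phi> x)"

definition K_fun ::
  "(real \<Rightarrow> real) \<Rightarrow> real \<Rightarrow> real \<Rightarrow> (real \<Rightarrow> real) \<Rightarrow> (real \<Rightarrow> real) \<Rightarrow> real \<Rightarrow> real" where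
  "K_fun M d D \<phi> \<omega> r =
     M (\<omega> r * real_of_ereal (A_phi M d D \<phi> r)) / \<bar>deriv \<phi> r\<bar> * exp (- \<phi> r)"

definition F_set :: "(real \<Rightarrow> real) \<Rightarrow> (real \<Rightarrow> real) \<Rightarrow> real set" where
  "F_set \<phi> \<omega> = {r. 0 < r \<and> \<omega> r \<noteq> 0 \<and> deriv \<omega> r * deriv \<phi> r > 0}"

definition G0_set :: "(real \<Rightarrow> real) \<Rightarrow> (real \<Rightarrow> real) \<Rightarrow> real set" where
  "G0_set \<phi> \<omega> = {r. 0 < r \<and> \<omega> r \<noteq> 0 \<and> deriv \<omega> r * deriv \<phi> r < 0}"

definition b1 :: "real \<Rightarrow> real \<Rightarrow> (real \<Rightarrow> real) \<Rightarrow> (real \<Rightarrow> real) \<Rightarrow> ereal" where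
  "b1 d D \<phi> \<omega> = (INF r\<in>{0<..}. ereal (1 + deriv (deriv \<phi>) r / (deriv \<phi> r)\<^sup>2
      - deriv \<omega> r / (\<omega> r * deriv \<phi> r) *
        (d * indicator (G0_set \<phi> \<omega>) r + D * indicator (F_set \<phi> \<omega>) r)))"

definition b2 :: "real \<Rightarrow> real \<Rightarrow> (real \<Rightarrow> real) \<Rightarrow> (real \<Rightarrow> real) \<Rightarrow> ereal" where
  "b2 d D \<phi> \<omega> = (INF r\<in>{0<..}. ereal (- 1 - deriv (deriv \<phi>) r / (deriv \<phi> r)\<^sup>2
      + deriv \<omega> r / (\<omega> r * deriv \<phi> r) *
        (d * indicator (F_set \<phi> \<omega>) r + D * indicator (G0_set \<phi> \<omega>) r)))"

definition L_const :: "(real \<Rightarrow> real) \<Rightarrow> (real \<Rightarrow> real) \<Rightarrow> ereal" where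
  "L_const \<phi> \<omega> = (SUP r\<in>{0<..}. ereal (\<omega> r / \<bar>deriv \<phi> r\<bar>))"

text \<open>A pair \<open>(s, t)\<close> in the family \<open>I\<close> stands for the interval from \<open>s\<close> to \<open>t\<close>.\<close>

definition abs_continuous_on :: "real \<Rightarrow> real \<Rightarrow> (real \<Rightarrow> real) \<Rightarrow> bool" where
  "abs_continuous_on a b u \<longleftrightarrow>
     (\<forall>\<epsilon>>0. \<exists>\<delta>>0. \<forall>I. finite I \<and> (\<forall>(s, t)\<in>I. a \<le> s \<and> s \<le> t \<and> t \<le> b) \<and>
        disjoint_family_on (\<lambda>(s, t). {s<..<t}) I \<and> (\<Sum>(s, t)\<in>I. t - s) < \<delta>
        \<longrightarrow> (\<Sum>(s, t)\<in>I. \<bar>u t - u s\<bar>) < \<epsilon>)"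

text \<open>The space \<open>W\<^sup>1\<^sup>,\<^sup>1\<close>-loc on the half-line, each class being represented by its locally absolutely
  continuous member; its (weak) derivative is the pointwise derivative, which exists almost
  everywhere and is locally integrable. By Lebesgue's theorem the second and third conditions
  follow from the first. In integrals over \<open>deriv u\<close>, the null set where \<open>u\<close> is not
  differentiable is immaterial.\<close>

definition W11_loc :: "(real \<Rightarrow> real) set" where
  "W11_loc = {u. (\<forall>a b. 0 < a \<and> a \<le> b \<longrightarrow> abs_continuous_on a b u) \<and>
     (AE x in lebesgue_on {0<..}. u differentiable (at x)) \<and>
     (\<forall>a b. 0 < a \<and> a \<le> b \<longrightarrow> set_integrable lebesgue {a..b} (deriv u))}"

definition hardy_transforms :: "(real \<Rightarrow> real) set" where
  "hardy_transforms = {u \<in> W11_loc. (u \<longlongrightarrow> 0) (at_right 0)}"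

definition G_fun ::
  "(real \<Rightarrow> real) \<Rightarrow> (real \<Rightarrow> real) \<Rightarrow> (real \<Rightarrow> real) \<Rightarrow> real \<Rightarrow> real \<Rightarrow> ennreal" where
  "G_fun M \<phi> \<omega> \<epsilon> y =
     (\<integral>\<^sup>+x. ennreal (M (\<epsilon> * \<omega> x) * exp (- \<phi> x)) \<partial>lebesgue_on {y<..})"

end

theory Submission
  imports Defs
begin

text \<open>
  Write \<open>N x = M \<bar>x\<bar>\<close>. The bounds on \<open>M' x \<cdot> x / M x\<close> say that \<open>M\<close> grows between the powers
  \<open>d\<close> and \<open>D\<close>, which gives three things: scaling inequalities for \<open>M\<close>, the domination of
  \<open>M (f\<^sub>\<phi> v)\<close> by \<open>M v \<cdot> e\<^sup>-\<^sup>\<phi>\<close>, and a Young-type inequality that absorbs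
  \<open>M s / s \<cdot> t\<close> into \<open>\<epsilon> M s + C M t\<close>.

  The Hardy inequality (i) comes from the energy \<open>h = N (\<omega> u) e\<^sup>-\<^sup>\<phi> / \<bar>\<phi>'\<bar>\<close>. Differentiating it, the
  terms in which \<open>u\<close> is not differentiated are at most \<open>- b N (\<omega> u) e\<^sup>-\<^sup>\<phi>\<close>; this is what
  positivity of the constants \<open>b\<^sub>1\<close> and \<open>b\<^sub>2\<close> expresses, and after multiplication by the sign of
  \<open>\<phi>'\<close> both cases read the same. The remaining term contains \<open>u'\<close>; it is controlled by the bound \<open>L\<close>
  and the Young-type inequality, half of the good term being spent. Thus
  \<open>h' + b/2 \<cdot> N (\<omega> u) e\<^sup>-\<^sup>\<phi> \<le> C \<cdot> M \<bar>u'\<bar> e\<^sup>-\<^sup>\<phi>\<close> almost everywhere (\<open>energy_deriv\<close>). As \<open>h\<close> is locally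
  absolutely continuous, this may be integrated (\<open>abs_continuous_increment_le\<close>). At the right end
  \<open>h \<ge> 0\<close> has the good sign. At the origin \<open>h\<close> tends to \<open>0\<close> (\<open>energy_vanishes_at_0\<close>): once
  \<open>\<integral>\<^sub>0\<^sup>r M \<bar>u'\<bar> e\<^sup>-\<^sup>\<phi>\<close> has dropped below \<open>t\<^sup>D\<close>, duality gives \<open>\<bar>u r\<bar> \<le> t A\<^sub>\<phi> r\<close>, hence
  \<open>h r \<le> t K r\<close> by convexity of \<open>M\<close>, and \<open>K\<close> is bounded.

  Assertion (ii) follows from the Hardy inequality alone. Given \<open>k = G / (B \<epsilon>)\<close>, test it with the
  primitive \<open>u\<close> of a function \<open>g\<close> on \<open>[a, y]\<close> for which \<open>k e\<^sup>\<phi> g - M g\<close> attains the supremum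
  defining \<open>M\<^sup>* (k e\<^sup>\<phi>)\<close>. Equality in Young's inequality reads
  \<open>\<integral> M\<^sup>* (k e\<^sup>\<phi>) e\<^sup>-\<^sup>\<phi> + \<integral> M g e\<^sup>-\<^sup>\<phi> = k u y\<close>, so it suffices that \<open>u y \<le> B \<epsilon>\<close>. Otherwise
  convexity gives \<open>N (\<omega> u) \<ge> u y / \<epsilon> \<cdot> M (\<epsilon> \<omega>)\<close> on \<open>(y, \<infinity>)\<close>, and the Hardy inequality
  yields \<open>u y / \<epsilon> \<cdot> G \<le> C k u y = C / B \<cdot> (u y / \<epsilon>) G\<close>, which is absurd for \<open>B > C\<close>.
\<close>

section \<open>Absolutely continuous functions\<close>

lemma abs_continuous_onE:
  assumes u: "abs_continuous_on a b u" and e: "0 < e"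
  obtains \<delta> where "0 < \<delta>"
    and "\<forall>I. finite I \<longrightarrow> (\<forall>(s, t)\<in>I. a \<le> s \<and> s \<le> t \<and> t \<le> b) \<longrightarrow>
        disjoint_family_on (\<lambda>(s, t). {s<..<t}) I \<longrightarrow> (\<Sum>(s, t)\<in>I. t - s) < \<delta>
        \<longrightarrow> (\<Sum>(s, t)\<in>I. \<bar>u t - u s\<bar>) < e"
  using u[unfolded abs_continuous_on_def, rule_format, OF e] by blast

text \<open>
  This transfers absolute continuity from \<open>u\<close> to a composite \<open>h x = H x (u x)\<close> with \<open>H\<close> Lipschitz;
  the energy below is of this form.
\<close>

lemma abs_continuous_on_dominated:
  assumes u: "abs_continuous_on a b u"
    and dom: "\<And>s t. a \<le> s \<Longrightarrow> s \<le> t \<Longrightarrow> t \<le> b \<Longrightarrow> \<bar>h t - h s\<bar> \<le> K * (\<bar>u t - u s\<bar> + (t - s))"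
  shows "abs_continuous_on a b h"
  unfolding abs_continuous_on_def
proof (intro allI impI)
  fix e :: real assume "0 < e"
  define k where "k = \<bar>K\<bar> + 1"
  have k: "0 < k" "K \<le> k" by (auto simp: k_def)
  define e' where "e' = e / (2 * k)"
  have e': "0 < e'" using \<open>0 < e\<close> k by (simp add: e'_def)
  obtain \<delta> where \<delta>: "0 < \<delta>"
      and ac: "\<forall>I. finite I \<longrightarrow> (\<forall>(s, t)\<in>I. a \<le> s \<and> s \<le> t \<and> t \<le> b) \<longrightarrow>
        disjoint_family_on (\<lambda>(s, t). {s<..<t}) I \<longrightarrow> (\<Sum>(s, t)\<in>I. t - s) < \<delta>
        \<longrightarrow> (\<Sum>(s, t)\<in>I. \<bar>u t - u s\<bar>) < e'"
      using abs_continuous_onE[OF u e'] .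
  show "\<exists>\<delta>>0. \<forall>I. finite I \<and> (\<forall>(s, t)\<in>I. a \<le> s \<and> s \<le> t \<and> t \<le> b) \<and>
        disjoint_family_on (\<lambda>(s, t). {s<..<t}) I \<and> (\<Sum>(s, t)\<in>I. t - s) < \<delta>
        \<longrightarrow> (\<Sum>(s, t)\<in>I. \<bar>h t - h s\<bar>) < e"
  proof (intro exI[of _ "min \<delta> e'"] conjI allI impI; (elim conjE)?)
    fix I :: "(real \<times> real) set"
    assume I: "finite I" "\<forall>(s, t)\<in>I. a \<le> s \<and> s \<le> t \<and> t \<le> b"
      "disjoint_family_on (\<lambda>(s, t). {s<..<t}) I" "(\<Sum>(s, t)\<in>I. t - s) < min \<delta> e'"
    have "(\<Sum>(s, t)\<in>I. \<bar>h t - h s\<bar>) \<le> (\<Sum>(s, t)\<in>I. k * (\<bar>u t - u s\<bar> + (t - s)))"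
    proof (intro sum_mono, clarify)
      fix s t assume "(s, t) \<in> I"
      then have st: "a \<le> s" "s \<le> t" "t \<le> b" using I by auto
      show "\<bar>h t - h s\<bar> \<le> k * (\<bar>u t - u s\<bar> + (t - s))"
        using dom[OF st] mult_right_mono[OF k(2), of "\<bar>u t - u s\<bar> + (t - s)"] st by linarith
    qed
    also have "\<dots> = k * ((\<Sum>(s, t)\<in>I. \<bar>u t - u s\<bar>) + (\<Sum>(s, t)\<in>I. t - s))"
      by (simp add: sum_distrib_left case_prod_unfold flip: sum.distrib)
    also have "\<dots> < k * (e' + e')"
      using ac[rule_format, of I] I k by (intro mult_strict_left_mono) auto
    also have "\<dots> = e" using k by (simp add: e'_def)
    finally show "(\<Sum>(s, t)\<in>I. \<bar>h t - h s\<bar>) < e" .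
  qed (use \<delta> e' in auto)
qed

lemma abs_continuous_on_Lipschitz:
  assumes "\<And>s t. a \<le> s \<Longrightarrow> s \<le> t \<Longrightarrow> t \<le> b \<Longrightarrow> \<bar>h t - h s\<bar> \<le> K * (t - s)"
  shows "abs_continuous_on a b h"
proof (rule abs_continuous_on_dominated)
  show "abs_continuous_on a b (\<lambda>x. 0)" by (auto simp: abs_continuous_on_def intro!: exI[of _ 1])
qed (use assms in auto)

lemma abs_continuous_on_add:
  assumes u: "abs_continuous_on a b u" and v: "abs_continuous_on a b v"
  shows "abs_continuous_on a b (\<lambda>x. u x + v x)"
  unfolding abs_continuous_on_def
proof (intro allI impI)
  fix e :: real assume "0 < e"
  obtain \<delta> where \<delta>: "0 < \<delta>"
      and uac: "\<forall>I. finite I \<longrightarrow> (\<forall>(s, t)\<in>I. a \<le> s \<and> s \<le> t \<and> t \<le> b) \<longrightarrow>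
        disjoint_family_on (\<lambda>(s, t). {s<..<t}) I \<longrightarrow> (\<Sum>(s, t)\<in>I. t - s) < \<delta>
        \<longrightarrow> (\<Sum>(s, t)\<in>I. \<bar>u t - u s\<bar>) < e / 2"
      using abs_continuous_onE[OF u half_gt_zero[OF \<open>0 < e\<close>]] .
  obtain \<delta>' where \<delta>': "0 < \<delta>'"
      and vac: "\<forall>I. finite I \<longrightarrow> (\<forall>(s, t)\<in>I. a \<le> s \<and> s \<le> t \<and> t \<le> b) \<longrightarrow>
        disjoint_family_on (\<lambda>(s, t). {s<..<t}) I \<longrightarrow> (\<Sum>(s, t)\<in>I. t - s) < \<delta>'
        \<longrightarrow> (\<Sum>(s, t)\<in>I. \<bar>v t - v s\<bar>) < e / 2"
      using abs_continuous_onE[OF v half_gt_zero[OF \<open>0 < e\<close>]] .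
  show "\<exists>\<delta>>0. \<forall>I. finite I \<and> (\<forall>(s, t)\<in>I. a \<le> s \<and> s \<le> t \<and> t \<le> b) \<and>
        disjoint_family_on (\<lambda>(s, t). {s<..<t}) I \<and> (\<Sum>(s, t)\<in>I. t - s) < \<delta>
        \<longrightarrow> (\<Sum>(s, t)\<in>I. \<bar>(u t + v t) - (u s + v s)\<bar>) < e"
  proof (intro exI[of _ "min \<delta> \<delta>'"] conjI allI impI; (elim conjE)?)
    fix I :: "(real \<times> real) set"
    assume I: "finite I" "\<forall>(s, t)\<in>I. a \<le> s \<and> s \<le> t \<and> t \<le> b"
      "disjoint_family_on (\<lambda>(s, t). {s<..<t}) I" "(\<Sum>(s, t)\<in>I. t - s) < min \<delta> \<delta>'"
    have "(\<Sum>(s, t)\<in>I. \<bar>(u t + v t) - (u s + v s)\<bar>)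
        \<le> (\<Sum>(s, t)\<in>I. \<bar>u t - u s\<bar> + \<bar>v t - v s\<bar>)"
      by (intro sum_mono) auto
    also have "\<dots> = (\<Sum>(s, t)\<in>I. \<bar>u t - u s\<bar>) + (\<Sum>(s, t)\<in>I. \<bar>v t - v s\<bar>)"
      by (simp add: case_prod_unfold flip: sum.distrib)
    also have "\<dots> < e / 2 + e / 2"
      using I uac vac by (intro add_strict_mono) auto
    finally show "(\<Sum>(s, t)\<in>I. \<bar>(u t + v t) - (u s + v s)\<bar>) < e" by simp
  qed (use \<delta> \<delta>' in auto)
qed

lemma abs_continuous_on_imp_continuous_on:
  assumes u: "abs_continuous_on a b u"
  shows "continuous_on {a..b} u"
  unfolding continuous_on_iff
proof (intro ballI allI impI)
  fix x and e :: real assume x: "x \<in> {a..b}" and "0 < e"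
  obtain \<delta> where \<delta>: "0 < \<delta>"
      and ac: "\<forall>I. finite I \<longrightarrow> (\<forall>(s, t)\<in>I. a \<le> s \<and> s \<le> t \<and> t \<le> b) \<longrightarrow>
        disjoint_family_on (\<lambda>(s, t). {s<..<t}) I \<longrightarrow> (\<Sum>(s, t)\<in>I. t - s) < \<delta>
        \<longrightarrow> (\<Sum>(s, t)\<in>I. \<bar>u t - u s\<bar>) < e"
      using abs_continuous_onE[OF u \<open>0 < e\<close>] .
  show "\<exists>d>0. \<forall>x'\<in>{a..b}. dist x' x < d \<longrightarrow> dist (u x') (u x) < e"
  proof (intro exI[of _ \<delta>] conjI ballI impI)
    fix y assume y: "y \<in> {a..b}" "dist y x < \<delta>"
    show "dist (u y) (u x) < e"
      using ac[rule_format, of "{(min x y, max x y)}"] x y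
      by (cases "x \<le> y") (auto simp: dist_real_def disjoint_family_on_def min_def max_def abs_minus_commute)
  qed (use \<delta> in auto)
qed

text \<open>
  The fundamental theorem of calculus for absolutely continuous functions, proved with gauges. At a
  tag where \<open>h\<close> is differentiable the usual estimate for a fine interval applies. The exceptional
  null set \<open>Z\<close> is covered by an open set of small measure, and the gauge at tags in \<open>Z\<close> confines
  their intervals to it; absolute continuity then makes the total increment of \<open>h\<close> over these
  intervals small. Integrability of the derivative is part of the conclusion.
\<close>

lemma abs_continuous_has_integral_deriv:
  assumes "a \<le> b" and h: "abs_continuous_on a b h" and Z: "negligible Z"
    and deriv: "\<And>x. x \<in> {a..b} - Z \<Longrightarrow> (h has_vector_derivative h' x) (at x within {a..b})"
  shows "(h' has_integral (h b - h a)) {a..b}"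
proof (cases "a = b")
  case True
  then show ?thesis by (simp add: has_integral_refl)
next
  case False
  define g where "g x = (if x \<in> Z then 0 else h' x)" for x
  have "(g has_integral (h b - h a)) (cbox a b)"
    unfolding has_integral_factor_content
  proof safe
    fix e0 :: real assume "0 < e0"
    define e where "e = e0 / 2"
    have e: "0 < e" using \<open>0 < e0\<close> by (simp add: e_def)
    have ab: "0 < e * (b - a)" using e False \<open>a \<le> b\<close> by simp
    obtain \<delta> where \<delta>: "0 < \<delta>"
      and ac: "\<forall>I. finite I \<longrightarrow> (\<forall>(s, t)\<in>I. a \<le> s \<and> s \<le> t \<and> t \<le> b) \<longrightarrow>
        disjoint_family_on (\<lambda>(s, t). {s<..<t}) I \<longrightarrow> (\<Sum>(s, t)\<in>I. t - s) < \<delta>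
        \<longrightarrow> (\<Sum>(s, t)\<in>I. \<bar>h t - h s\<bar>) < e * (b - a)"
      using abs_continuous_onE[OF h ab] .
    \<comment> \<open>an open neighbourhood of \<open>Z\<close> so small that \<open>h\<close> varies little on intervals inside it\<close>
    have Zn: "Z \<in> null_sets lebesgue" using Z by (simp add: negligible_iff_null_sets)
    then obtain T where T: "open T" "Z \<subseteq> T" "T - Z \<in> lmeasurable" "emeasure lebesgue (T - Z) < ennreal \<delta>"
      using sets_lebesgue_outer_open[of Z \<delta>] \<delta> by blast
    have T_eq: "emeasure lebesgue T = emeasure lebesgue (T - Z)"
      using Zn by (metis emeasure_Diff_null_set T(1) borel_open lborelD sets_completionI_sets sets_lborel)
    have Tl: "T \<in> lmeasurable" using T_eq T
      by (intro fmeasurableI) (auto simp: less_top[symmetric] top_unique intro: borel_open)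
    have mT: "measure lebesgue T < \<delta>"
      using T(4) T_eq \<delta> by (metis emeasure_eq_measure2 Tl ennreal_less_iff measure_nonneg)
    have "\<forall>x. \<exists>d>0. (x \<in> {a..b} - Z \<longrightarrow>
         (\<forall>y\<in>{a..b}. norm (y-x) < d \<longrightarrow> norm (h y - h x - (y-x) *\<^sub>R h' x) \<le> e * norm (y-x)))
         \<and> (x \<in> Z \<longrightarrow> ball x d \<subseteq> T)"
    proof
      fix x
      show "\<exists>d>0. (x \<in> {a..b} - Z \<longrightarrow>
         (\<forall>y\<in>{a..b}. norm (y-x) < d \<longrightarrow> norm (h y - h x - (y-x) *\<^sub>R h' x) \<le> e * norm (y-x)))
         \<and> (x \<in> Z \<longrightarrow> ball x d \<subseteq> T)"
      proof (cases "x \<in> Z")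
        case True
        then show ?thesis using T by (meson DiffD2 open_contains_ball subset_eq)
      next
        case False
        show ?thesis
        proof (cases "x \<in> {a..b}")
          case True
          then have "\<exists>d>0. \<forall>y\<in>{a..b}. norm (y-x) < d \<longrightarrow> norm (h y - h x - (y-x) *\<^sub>R h' x) \<le> e * norm (y-x)"
            using deriv[of x] False e
            unfolding has_vector_derivative_def has_derivative_within_alt by blast
          with False show ?thesis by blast
        qed (use False zero_less_one in blast)
      qed
    qed
    then obtain d where d: "\<And>x. 0 < d x" "\<And>x. x \<in> Z \<Longrightarrow> ball x (d x) \<subseteq> T"
       "\<And>x y. \<lbrakk>x \<in> {a..b} - Z; y \<in> {a..b}; norm (y-x) < d x\<rbrakk>
                        \<Longrightarrow> norm (h y - h x - (y-x) *\<^sub>R h' x) \<le> e * norm (y-x)"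
      by metis
    show "\<exists>d. gauge d \<and> (\<forall>p. p tagged_division_of cbox a b \<and> d fine p \<longrightarrow>
      norm ((\<Sum>(x, k)\<in>p. measure lborel k *\<^sub>R g x) - (h b - h a)) \<le> e0 * measure lborel (cbox a b))"
    proof (rule exI, safe)
      show "gauge (\<lambda>x. ball x (d x))"
        using d(1) gauge_ball_dependent by blast
    next
      fix p
      assume ptag: "p tagged_division_of cbox a b" and finep: "(\<lambda>x. ball x (d x)) fine p"
      have ba: "b - a = (\<Sum>(x,K)\<in>p. Sup K - Inf K)" "h b - h a = (\<Sum>(x,K)\<in>p. h(Sup K) - h(Inf K))"
        using additive_tagged_division_1[where f= "\<lambda>x. x"] additive_tagged_division_1[where f= h]
            \<open>a \<le> b\<close> ptag by auto
      have fin: "finite p" using ptag by blast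
      have piece: "\<exists>u v. K = {u..v} \<and> u \<le> x \<and> x \<le> v \<and> a \<le> u \<and> v \<le> b \<and> {u..v} \<subseteq> ball x (d x)
                      \<and> Inf K = u \<and> Sup K = v" if xK: "(x, K) \<in> p" for x K
      proof -
        obtain u v where K: "K = cbox u v" "x \<in> K" "K \<subseteq> cbox a b"
          using tagged_division_ofD(2-4)[OF ptag xK] by metis
        have "K \<subseteq> ball x (d x)" using finep xK by (auto simp: fine_def)
        moreover have "u \<le> x" "x \<le> v" "a \<le> u" "v \<le> b" using K by auto
        ultimately show ?thesis using K(1) by (intro exI[of _ u] exI[of _ v]) auto
      qed
      \<comment> \<open>intervals tagged in \<open>Z\<close>; distinct ones with the same end points are degenerate\<close>
      define bad where "bad = {xK \<in> p. fst xK \<in> Z}"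
      have bad_sub: "bad \<subseteq> p" "finite bad" using fin by (auto simp: bad_def)
      let ?f = "\<lambda>xK::real \<times> real set. (Inf (snd xK), Sup (snd xK))"
      define I where "I = ?f ` bad"
      have int_disj: "{Inf K<..<Sup K} \<inter> {Inf K'<..<Sup K'} = {}"
        if "(x, K) \<in> p" "(x', K') \<in> p" "(x, K) \<noteq> (x', K')" for x x' K K'
      proof -
        have "interior K \<inter> interior K' = {}"
          using tagged_division_ofD(5)[OF ptag that] .
        moreover have "interior K = {Inf K<..<Sup K}" "interior K' = {Inf K'<..<Sup K'}"
          using piece[OF that(1)] piece[OF that(2)] by (metis interior_atLeastAtMost_real)+
        ultimately show ?thesis by simp
      qed
      have disj: "disjoint_family_on (\<lambda>(s, t). {s<..<t}) I"
        unfolding disjoint_family_on_def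
      proof (intro ballI impI)
        fix m n assume mn: "m \<in> I" "n \<in> I" "m \<noteq> n"
        obtain x K where 1: "(x, K) \<in> bad" "m = (Inf K, Sup K)"
          using mn(1) by (auto simp: I_def)
        obtain x' K' where 2: "(x', K') \<in> bad" "n = (Inf K', Sup K')"
          using mn(2) by (auto simp: I_def)
        note * = 1 2
        then have "(x, K) \<noteq> (x', K')" using mn(3) by auto
        with * bad_sub show "(case m of (s, t) \<Rightarrow> {s<..<t}) \<inter> (case n of (s, t) \<Rightarrow> {s<..<t}) = {}"
          using int_disj[of x K x' K'] by auto
      qed
      have le: "Inf K \<le> Sup K" if "(x, K) \<in> bad" for x K
        using piece[of x K] that bad_sub by auto
      have len: "(\<Sum>(s, t)\<in>I. t - s) < \<delta>"
      proof -
        have "(\<Sum>(s, t)\<in>I. t - s) = (\<Sum>st\<in>I. measure lebesgue ((\<lambda>(s, t). {s<..<t}) st))"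
          by (intro sum.cong refl) (auto simp: I_def le)
        also have "\<dots> = measure lebesgue (\<Union>st\<in>I. (\<lambda>(s, t). {s<..<t}) st)"
          using disj bad_sub by (intro measure_finite_Union[symmetric]) (auto simp: I_def le)
        also have "\<dots> \<le> measure lebesgue T"
        proof (rule measure_mono_fmeasurable)
          show "(\<Union>st\<in>I. (\<lambda>(s, t). {s<..<t}) st) \<subseteq> T"
          proof (clarsimp simp: I_def)
            fix x K y assume xK: "(x, K) \<in> bad" and y: "Inf K < y" "y < Sup K"
            then have "y \<in> ball x (d x)" using piece[of x K] bad_sub by (force simp: subset_eq)
            moreover have "x \<in> Z" using xK by (simp add: bad_def)
            ultimately show "y \<in> T" using d(2) by blast
          qed
        qed (use Tl bad_sub in \<open>auto simp: I_def intro!: sets.finite_UN\<close>)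
        finally show ?thesis using mT by simp
      qed
      have Zpart: "(\<Sum>(x,K)\<in>bad. \<bar>h (Sup K) - h (Inf K)\<bar>) < e * (b - a)"
      proof -
        have "(\<Sum>(s, t)\<in>I. \<bar>h t - h s\<bar>) = (\<Sum>xK\<in>bad. (\<lambda>(s, t). \<bar>h t - h s\<bar>) (?f xK))"
          unfolding I_def
        proof (rule sum.reindex_nontrivial[unfolded o_def])
          fix y y' assume *: "y \<in> bad" "y' \<in> bad" "y \<noteq> y'" "?f y = ?f y'"
          obtain x K x' K' where yy: "y = (x, K)" "y' = (x', K')" by (metis prod.exhaust)
          have "{Inf K<..<Sup K} = {}" using int_disj[of x K x' K'] * bad_sub yy by auto
          moreover have "Inf K \<le> Sup K" using piece[of x K] * bad_sub yy by force
          ultimately show "(\<lambda>(s, t). \<bar>h t - h s\<bar>) (?f y) = 0" using yy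
            by (auto simp: greaterThanLessThan_empty_iff)
        qed (use bad_sub in auto)
        moreover have rng: "\<forall>(s, t)\<in>I. a \<le> s \<and> s \<le> t \<and> t \<le> b"
          using piece bad_sub by (fastforce simp: I_def)
        have "finite I" using bad_sub by (simp add: I_def)
        then have "(\<Sum>(s, t)\<in>I. \<bar>h t - h s\<bar>) < e * (b - a)"
          by (rule ac[THEN spec, THEN mp, THEN mp, THEN mp, THEN mp, OF _ rng disj len])
        ultimately show ?thesis by (simp add: case_prod_unfold)
      qed
      have good: "norm (measure lborel K *\<^sub>R g x - (h (Sup K) - h (Inf K))) \<le> e * (Sup K - Inf K)"
        if xK: "(x, K) \<in> p" "x \<notin> Z" for x K
      proof -
        obtain u v where K: "K = {u..v}" "u \<le> x" "x \<le> v" "a \<le> u" "v \<le> b" "{u..v} \<subseteq> ball x (d x)"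
            "Inf K = u" "Sup K = v"
          using piece[OF xK(1)] by blast
        have "u \<in> ball x (d x)" "v \<in> ball x (d x)"
          using subsetD[OF K(6)] K(2,3) by auto
        then have "norm (h u - h x - (u-x) *\<^sub>R h' x) \<le> e * norm (u-x)"
             "norm (h v - h x - (v-x) *\<^sub>R h' x) \<le> e * norm (v-x)"
          using K xK d(3)[of x u] d(3)[of x v] by (auto simp: dist_real_def)
        moreover have "norm (u - x) = x - u" "norm (v - x) = v - x" using K by auto
        moreover have "measure lborel K *\<^sub>R g x - (h (Sup K) - h (Inf K))
            = (h u - h x - (u-x) *\<^sub>R h' x) - (h v - h x - (v-x) *\<^sub>R h' x)"
          unfolding K(7,8) using K(1-3) xK(2) by (simp add: g_def algebra_simps)
        moreover have "e * (Sup K - Inf K) = e * (x - u) + e * (v - x)"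
          unfolding K(7,8) by (simp add: algebra_simps)
        ultimately show ?thesis
          using norm_triangle_ineq4[of "h u - h x - (u-x) *\<^sub>R h' x" "h v - h x - (v-x) *\<^sub>R h' x"]
          by simp
      qed
      have "norm ((\<Sum>(x, K)\<in>p. measure lborel K *\<^sub>R g x) - (h b - h a))
         = norm (\<Sum>(x, K)\<in>p. measure lborel K *\<^sub>R g x - (h (Sup K) - h (Inf K)))"
        unfolding ba by (simp add: case_prod_unfold sum_subtractf)
      also have "\<dots> \<le> (\<Sum>(x, K)\<in>p. e * (Sup K - Inf K) + (if x \<in> Z then \<bar>h (Sup K) - h (Inf K)\<bar> else 0))"
      proof (rule sum_norm_le, clarify)
        fix x K assume xK: "(x, K) \<in> p"
        have "Inf K \<le> Sup K" using piece[OF xK] by auto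
        then have "0 \<le> e * (Sup K - Inf K)" using e by simp
        then show "norm (measure lborel K *\<^sub>R g x - (h (Sup K) - h (Inf K)))
              \<le> e * (Sup K - Inf K) + (if x \<in> Z then \<bar>h (Sup K) - h (Inf K)\<bar> else 0)"
          using good[OF xK] by (cases "x \<in> Z") (auto simp: g_def)
      qed
      also have "\<dots> = e * (b - a) + (\<Sum>(x, K)\<in>bad. \<bar>h (Sup K) - h (Inf K)\<bar>)"
        unfolding ba(1) bad_def using fin
        by (simp add: case_prod_unfold sum.distrib sum_distrib_left sum.inter_filter)
      also have "\<dots> \<le> e0 * measure lborel (cbox a b)"
        using Zpart \<open>a \<le> b\<close> by (simp add: e_def field_simps)
      finally show "norm ((\<Sum>(x, K)\<in>p. measure lborel K *\<^sub>R g x) - (h b - h a)) \<le> e0 * measure lborel (cbox a b)" .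
    qed
  qed
  then show ?thesis
    by (intro has_integral_spike[OF Z, of "{a..b}" h' g]) (auto simp: g_def)
qed

text \<open>
  The form in which differential inequalities are integrated. The exceptional null set is harmless
  because \<open>h\<close> is absolutely continuous.
\<close>

lemma abs_continuous_increment_le:
  assumes "a \<le> b" and h: "abs_continuous_on a b h"
    and deriv: "AE x in lebesgue_on {a..b}. \<exists>l. (h has_real_derivative l) (at x) \<and> l \<le> F x"
    and F: "F \<in> borel_measurable (lebesgue_on {a..b})" "\<And>x. x \<in> {a..b} \<Longrightarrow> 0 \<le> F x"
  shows "ennreal (h b - h a) \<le> (\<integral>\<^sup>+x. ennreal (F x) \<partial>lebesgue_on {a..b})"
proof (cases "(\<integral>\<^sup>+x. ennreal (F x) \<partial>lebesgue_on {a..b}) = \<infinity>")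
  case False
  have int: "integrable (lebesgue_on {a..b}) F"
    using F False by (intro integrableI_nonneg) (auto simp: less_top space_restrict_space intro!: AE_I2)
  obtain Z where Z: "Z \<in> null_sets (lebesgue_on {a..b})"
    "\<And>x. x \<in> {a..b} - Z \<Longrightarrow> \<exists>l. (h has_real_derivative l) (at x) \<and> l \<le> F x"
    using AE_E3[OF deriv] by (auto simp: space_restrict_space)
  have neg: "negligible Z" using Z(1)
    by (metis atLeastAtMost_borel lborelD negligible_iff_null_sets null_sets_restrict_space sets_completionI_sets sets_lborel)
  obtain h' where h': "\<And>x. x \<in> {a..b} - Z \<Longrightarrow> (h has_real_derivative h' x) (at x) \<and> h' x \<le> F x"
    using Z(2) by metis
  have "((\<lambda>x. if x \<in> Z then F x else h' x) has_integral (h b - h a)) {a..b}"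
    using h' by (intro abs_continuous_has_integral_deriv[OF \<open>a \<le> b\<close> h neg])
      (auto simp: has_real_derivative_iff_has_vector_derivative[symmetric] intro: has_field_derivative_at_within)
  moreover have "(F has_integral integral\<^sup>L (lebesgue_on {a..b}) F) {a..b}"
    using int by (intro has_integral_integral_lebesgue_on) auto
  ultimately have "h b - h a \<le> integral\<^sup>L (lebesgue_on {a..b}) F"
    by (rule has_integral_le) (use h' in auto)
  then have "ennreal (h b - h a) \<le> ennreal (integral\<^sup>L (lebesgue_on {a..b}) F)"
    by (rule ennreal_leI)
  also have "\<dots> = (\<integral>\<^sup>+x. ennreal (F x) \<partial>lebesgue_on {a..b})"
    using F by (intro nn_integral_eq_integral[symmetric] int AE_I2) auto
  finally show ?thesis .
qed simp

section \<open>Growth of the Young function\<close>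

text \<open>
  The sign of \<open>M' z - p M z / z\<close> is the sign of the derivative of \<open>M z / z\<^sup>p\<close>.
\<close>

lemma power_growth_of_log_derivative:
  fixes M :: "real \<Rightarrow> real"
  assumes diff: "\<And>x. 0 < x \<Longrightarrow> (M has_real_derivative M' x) (at x)"
    and xy: "0 < x" "x \<le> y"
  shows "(\<And>z. 0 < z \<Longrightarrow> p * (M z / z) \<le> M' z) \<Longrightarrow> M x / x powr p \<le> M y / y powr p"
    and "(\<And>z. 0 < z \<Longrightarrow> M' z \<le> p * (M z / z)) \<Longrightarrow> M y / y powr p \<le> M x / x powr p"
proof -
  have d: "((\<lambda>x. M x / x powr p) has_real_derivative (M' z - p * (M z / z)) / z powr p) (at z)"
    if "0 < z" for z
    using that by (auto intro!: derivative_eq_intros diff simp: field_simps powr_diff power2_eq_square)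
  show "M x / x powr p \<le> M y / y powr p" if le: "\<And>z. 0 < z \<Longrightarrow> p * (M z / z) \<le> M' z"
  proof (rule DERIV_nonneg_imp_nondecreasing[OF xy(2)])
    fix z assume "x \<le> z" "z \<le> y"
    with xy have "0 < z" by simp
    with le show "\<exists>l. ((\<lambda>x. M x / x powr p) has_real_derivative l) (at z) \<and> 0 \<le> l"
      by (intro exI[of _ "(M' z - p * (M z / z)) / z powr p"] conjI d[OF \<open>0 < z\<close>] divide_nonneg_nonneg) auto
  qed
  show "M y / y powr p \<le> M x / x powr p" if le: "\<And>z. 0 < z \<Longrightarrow> M' z \<le> p * (M z / z)"
  proof (rule DERIV_nonpos_imp_nonincreasing[OF xy(2)])
    fix z assume "x \<le> z" "z \<le> y"
    with xy have "0 < z" by simp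
    with le show "\<exists>l. ((\<lambda>x. M x / x powr p) has_real_derivative l) (at z) \<and> l \<le> 0"
      by (intro exI[of _ "(M' z - p * (M z / z)) / z powr p"] conjI d[OF \<open>0 < z\<close>] divide_nonpos_nonneg) auto
  qed
qed

locale growth_function =
  fixes M :: "real \<Rightarrow> real" and d D :: real
  assumes N_fun: "N_function M"
    and diff_M: "M differentiable_on {0..}"
    and d_ge: "1 \<le> d" and d_le_D: "d \<le> D"
    and growth: "\<forall>x>0. d * (M x / x) \<le> deriv M x \<and> deriv M x \<le> D * (M x / x)"
begin

lemma M_nonneg: "0 \<le> x \<Longrightarrow> 0 \<le> M x"
  using N_fun by (simp add: N_function_def)

lemma M_continuous: "continuous_on {0..} M"
  using N_fun by (simp add: N_function_def)

lemma M_convex: "convex_on {0..} M"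
  using N_fun by (simp add: N_function_def)

lemma M_over_0: "((\<lambda>x. M x / x) \<longlongrightarrow> 0) (at_right 0)"
  using N_fun by (simp add: N_function_def)

lemma M_over_top: "filterlim (\<lambda>x. M x / x) at_top at_top"
  using N_fun by (simp add: N_function_def)

lemma M_deriv: "0 < x \<Longrightarrow> (M has_real_derivative deriv M x) (at x)"
proof -
  assume x: "0 < x"
  have "M differentiable_on {0<..}"
    by (rule differentiable_on_subset[OF diff_M]) auto
  then have "M differentiable (at x)" using x by (simp add: differentiable_on_eq_differentiable_at)
  then show ?thesis
    using DERIV_deriv_iff_real_differentiable by blast
qed

text \<open>
  \<open>M x = (M x / x) x\<close> tends to \<open>0\<close> at the origin, where \<open>M\<close> is continuous.
\<close>

lemma M_zero [simp]: "M 0 = 0"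
proof -
  have "((\<lambda>x. M x / x * x) \<longlongrightarrow> 0 * 0) (at_right 0)"
    by (intro tendsto_mult M_over_0) auto
  moreover have "\<forall>\<^sub>F x in at_right 0. M x / x * x = M x"
    by (auto simp: eventually_at_right_field intro!: exI[of _ 1])
  ultimately have "(M \<longlongrightarrow> 0 * 0) (at_right 0)"
    by (rule Lim_transform_eventually)
  moreover have "(M \<longlongrightarrow> M 0) (at_right 0)"
  proof (rule tendsto_within_subset)
    show "(M \<longlongrightarrow> M 0) (at 0 within {0..})"
      using M_continuous by (auto simp: continuous_on_def)
  qed auto
  ultimately have "M 0 = 0 * 0"
    by (intro tendsto_unique[of "at_right (0::real)" M]) auto
  then show ?thesis by simp
qed

lemma M_scale_le:
  assumes "0 \<le> x" "0 \<le> s" "s \<le> 1"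
  shows "M (s * x) \<le> s * M x"
  using convex_onD[OF M_convex, of s 0 x] assms by simp

lemma M_scale_ge:
  assumes "0 \<le> x" "1 \<le> s"
  shows "s * M x \<le> M (s * x)"
proof -
  have "M ((1 / s) * (s * x)) \<le> (1 / s) * M (s * x)"
    using assms by (intro M_scale_le) auto
  then show ?thesis using assms by (simp add: pos_le_divide_eq mult.commute)
qed

lemma M_mono: "0 \<le> x \<Longrightarrow> x \<le> y \<Longrightarrow> M x \<le> M y"
proof (cases "y = 0")
  case False
  assume xy: "0 \<le> x" "x \<le> y"
  with False have "0 < y" by simp
  then have "M (x / y * y) \<le> x / y * M y" using xy by (intro M_scale_le) auto
  also have "\<dots> \<le> 1 * M y" using xy \<open>0 < y\<close> M_nonneg by (intro mult_right_mono) auto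
  finally show ?thesis using \<open>0 < y\<close> by simp
qed auto

lemma M_power_bound_small:
  assumes "0 \<le> x" "0 \<le> s" "s \<le> 1"
  shows "M (s * x) \<le> s powr d * M x"
proof (cases "s = 0 \<or> x = 0")
  case False
  then have *: "0 < s * x" "0 < x" using assms by auto
  have "s * x \<le> 1 * x" using assms by (intro mult_right_mono) auto
  then have "M (s * x) / (s * x) powr d \<le> M x / x powr d"
    using * growth by (intro power_growth_of_log_derivative(1)[of M "deriv M"] M_deriv) auto
  then have "M (s * x) \<le> M x / x powr d * (s * x) powr d"
    by (subst (asm) pos_divide_le_eq) (use * in auto)
  then show ?thesis using * assms by (simp add: powr_mult mult.commute)
qed auto

lemma M_power_bound_large:
  assumes "0 \<le> x" "1 \<le> s"
  shows "M (s * x) \<le> s powr D * M x"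
proof (cases "x = 0")
  case False
  then have *: "0 < x" "0 < s * x" using assms by auto
  have "1 * x \<le> s * x" using assms by (intro mult_right_mono) auto
  then have "M (s * x) / (s * x) powr D \<le> M x / x powr D"
    using * growth by (intro power_growth_of_log_derivative(2)[of M "deriv M"] M_deriv) auto
  then have "M (s * x) \<le> M x / x powr D * (s * x) powr D"
    by (subst (asm) pos_divide_le_eq) (use * in auto)
  then show ?thesis using * assms by (simp add: powr_mult mult.commute)
qed auto

lemma M_c_fun_bound:
  assumes "0 \<le> x" "0 \<le> s"
  shows "M (s * x) \<le> c_fun d D s * M x"
proof (cases "s \<le> 1")
  case True
  then have "M (s * x) \<le> s powr d * M x" using assms by (intro M_power_bound_small) auto
  also have "\<dots> \<le> c_fun d D s * M x"
    using assms M_nonneg by (intro mult_right_mono) (auto simp: c_fun_def)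
  finally show ?thesis .
next
  case False
  then have "M (s * x) \<le> s powr D * M x" using assms by (intro M_power_bound_large) auto
  also have "\<dots> \<le> c_fun d D s * M x"
    using assms M_nonneg by (intro mult_right_mono) (auto simp: c_fun_def)
  finally show ?thesis .
qed

text \<open>
  If \<open>t \<le> \<epsilon> s\<close> the first term on the right suffices. Otherwise the quotient \<open>M s / s\<close>, which
  increases with \<open>s\<close>, is evaluated at \<open>t / \<epsilon> > s\<close> instead, and the growth bound removes
  the factor \<open>1 / \<epsilon>\<close> from the argument.
\<close>

lemma M_young:
  assumes s: "0 < s" and t: "0 \<le> t" and \<epsilon>: "0 < \<epsilon>" "\<epsilon> \<le> 1"
  shows "M s / s * t \<le> \<epsilon> * M s + (1 / \<epsilon>) powr D * M t"
proof (cases "t \<le> \<epsilon> * s")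
  case True
  then have "M s / s * t \<le> M s / s * (\<epsilon> * s)"
    using s M_nonneg[of s] by (intro mult_left_mono) auto
  also have "\<dots> = \<epsilon> * M s" using s by simp
  finally show ?thesis using t M_nonneg[of t] by (auto intro: add_increasing2)
next
  case False
  define r where "r = t / (\<epsilon> * s)"
  have r: "1 \<le> r" "r * s = 1 / \<epsilon> * t" using False s \<epsilon> by (auto simp: r_def field_simps)
  have "M s / s * t = \<epsilon> * (r * M s)" using s \<epsilon> by (simp add: r_def)
  also have "\<dots> \<le> \<epsilon> * M (r * s)" using r s \<epsilon> by (intro mult_left_mono M_scale_ge) auto
  also have "\<dots> \<le> 1 * M (1 / \<epsilon> * t)" unfolding r(2) using \<epsilon> t by (intro mult_right_mono M_nonneg) auto
  also have "\<dots> \<le> (1 / \<epsilon>) powr D * M t" using \<epsilon> t M_power_bound_large[of t "1 / \<epsilon>"] by simp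
  finally show ?thesis using s \<epsilon> M_nonneg[of s] by (auto intro: add_increasing)
qed

lemma deriv_M_nonneg: "0 < x \<Longrightarrow> 0 \<le> deriv M x"
  using growth d_ge M_nonneg[of x]
  by (smt (verit) divide_nonneg_pos mult_nonneg_nonneg)

definition even_deriv :: "real \<Rightarrow> real" where
  "even_deriv x = (if x = 0 then 0 else sgn x * deriv M \<bar>x\<bar>)"

text \<open>
  The even extension of \<open>M\<close> is differentiable at \<open>0\<close> as well, because \<open>M x / x\<close> tends to \<open>0\<close>.
  This makes it possible to differentiate \<open>M \<bar>\<omega> u\<bar>\<close> wherever \<open>u\<close> is differentiable, in particular
  at zeros of \<open>u\<close>.
\<close>

lemma M_abs_deriv: "((\<lambda>x. M \<bar>x\<bar>) has_real_derivative even_deriv x) (at x)"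
proof -
  consider "0 < x" | "x < 0" | "x = 0" by linarith
  then show ?thesis
  proof cases
    case 1
    have "((\<lambda>x. M \<bar>x\<bar>) has_real_derivative deriv M x) (at x)"
      by (rule has_field_derivative_transform_within_open[OF M_deriv[OF 1], of "{0<..}"]) (use 1 in auto)
    then show ?thesis using 1 by (simp add: even_deriv_def)
  next
    case 2
    have "((\<lambda>x. M (- x)) has_real_derivative deriv M (- x) * (- 1)) (at x)"
      using 2 by (intro DERIV_chain2[OF M_deriv]) (auto intro!: derivative_eq_intros)
    then have "((\<lambda>x. M \<bar>x\<bar>) has_real_derivative deriv M (- x) * (- 1)) (at x)"
      by (rule has_field_derivative_transform_within_open[of _ _ _ "{..<0}"]) (use 2 in auto)
    then show ?thesis using 2 by (simp add: even_deriv_def)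
  next
    case 3
    have r: "((\<lambda>h. M \<bar>h\<bar> / h) \<longlongrightarrow> 0) (at_right 0)"
      by (rule Lim_transform_eventually[OF M_over_0])
        (auto simp: eventually_at_right_field intro!: exI[of _ 1])
    have "((\<lambda>h. M \<bar>- h\<bar> / (- h)) \<longlongrightarrow> 0) (at_right 0)"
      by (rule Lim_transform_eventually[OF tendsto_minus[OF M_over_0, unfolded minus_zero]])
        (auto simp: eventually_at_right_field intro!: exI[of _ 1])
    then have l: "((\<lambda>h. M \<bar>h\<bar> / h) \<longlongrightarrow> 0) (at_left 0)"
      by (simp add: filterlim_at_left_to_right)
    have "((\<lambda>h. M \<bar>h\<bar> / h) \<longlongrightarrow> 0) (at 0)"
      using l r by (simp add: filterlim_split_at)
    then show ?thesis using 3 by (simp add: DERIV_def even_deriv_def)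
  qed
qed

lemma M_abs_continuous: "continuous_on UNIV (\<lambda>x. M \<bar>x\<bar>)"
  using M_abs_deriv by (meson DERIV_isCont continuous_at_imp_continuous_on)

lemma M_abs_measurable [measurable]: "(\<lambda>x. M \<bar>x\<bar>) \<in> borel_measurable borel"
  using M_abs_continuous by (intro borel_measurable_continuous_onI)

lemma even_deriv_bound: "\<bar>even_deriv x\<bar> \<le> D * (M \<bar>x\<bar> / \<bar>x\<bar>)"
  using growth deriv_M_nonneg[of "\<bar>x\<bar>"] by (auto simp: even_deriv_def abs_mult)

lemma M_ratio_mono: "0 < x \<Longrightarrow> x \<le> y \<Longrightarrow> M x / x \<le> M y / y"
proof -
  assume xy: "0 < x" "x \<le> y"
  then have "M (x / y * y) \<le> x / y * M y" by (intro M_scale_le) auto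
  then show ?thesis using xy by (simp add: pos_divide_le_eq mult.commute)
qed

lemma M_abs_Lipschitz:
  assumes "\<bar>x\<bar> \<le> V" "\<bar>y\<bar> \<le> V"
  shows "\<bar>M \<bar>y\<bar> - M \<bar>x\<bar>\<bar> \<le> D * (M V / V) * \<bar>y - x\<bar>"
proof -
  have D: "0 \<le> D" using d_ge d_le_D by linarith
  have *: "\<bar>even_deriv z\<bar> \<le> D * (M V / V)" if "\<bar>z\<bar> \<le> V" for z
  proof (cases "z = 0")
    case True
    then show ?thesis using that D M_nonneg[of V] by (auto simp: even_deriv_def)
  next
    case False
    have "M \<bar>z\<bar> / \<bar>z\<bar> \<le> M V / V" using False that by (intro M_ratio_mono) auto
    then show ?thesis using even_deriv_bound[of z] D by (meson mult_left_mono order_trans)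
  qed
  have "norm (M \<bar>y\<bar> - M \<bar>x\<bar>) \<le> D * (M V / V) * norm (y - x)"
    by (rule field_differentiable_bound[where S="{-V..V}" and f'=even_deriv])
      (use assms * in \<open>auto intro: has_field_derivative_at_within[OF M_abs_deriv]\<close>)
  then show ?thesis by simp
qed

lemma c_fun_strict_mono: "strict_mono_on {0..} (c_fun d D)"
proof (rule strict_mono_onI)
  fix x y :: real assume "x \<in> {0..}" "y \<in> {0..}" "x < y"
  then have "x powr d < y powr d" "x powr D < y powr D"
    using d_ge d_le_D by (auto intro: powr_less_mono2)
  then show "c_fun d D x < c_fun d D y" by (auto simp: c_fun_def)
qed

text \<open>
  For \<open>y \<le> 1\<close> the inverse of \<open>max (x\<^sup>d) (x\<^sup>D)\<close> is the \<open>d\<close>-th root and for \<open>y \<ge> 1\<close> the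
  \<open>D\<close>-th root; in both cases it is the smaller of the two. The closed form also supplies the
  measurability of \<open>f\<^sub>\<phi>\<close>.
\<close>

lemma f_phi_inverse:
  shows f_phi_eq: "f_phi d D \<phi> r = min (exp (- \<phi> r / d)) (exp (- \<phi> r / D))"
    and c_fun_f_phi: "c_fun d D (f_phi d D \<phi> r) = exp (- \<phi> r)"
proof -
  have dD: "0 < d" "0 < D" using d_ge d_le_D by auto
  define y where "y = - \<phi> r"
  have p: "exp (y / p) powr q = exp (y * (q / p))" if "0 < p" for p q
    by (simp add: powr_def)
  have c: "c_fun d D (min (exp (y / d)) (exp (y / D))) = exp y"
  proof (cases "0 \<le> y")
    case True
    then have "y / D \<le> y / d" using dD d_le_D by (intro divide_left_mono) auto
    moreover have "y * (d / D) \<le> y * 1" using True dD d_le_D by (intro mult_left_mono) auto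
    ultimately show ?thesis using dD by (auto simp: c_fun_def p min_def max_def)
  next
    case False
    then have "y / d \<le> y / D" using dD d_le_D by (intro divide_left_mono_neg) auto
    moreover have "y * (D / d) \<le> y * 1" using False dD d_le_D by (intro mult_left_mono_neg) auto
    ultimately show ?thesis using dD by (auto simp: c_fun_def p min_def max_def)
  qed
  show eq: "f_phi d D \<phi> r = min (exp (- \<phi> r / d)) (exp (- \<phi> r / D))"
    using c unfolding f_phi_def y_def
    by (intro inv_into_f_eq strict_mono_on_imp_inj_on[OF c_fun_strict_mono]) auto
  show "c_fun d D (f_phi d D \<phi> r) = exp (- \<phi> r)"
    using c unfolding eq y_def by simp
qed

lemma f_phi_pos: "0 < f_phi d D \<phi> r"
  by (simp add: f_phi_eq)

text \<open>
  From some point on \<open>M z / z \<ge> t\<close>, so that \<open>t z - M z\<close> is at most its value \<open>0\<close> at the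
  origin; before that point compactness applies.
\<close>

lemma legendre_maximiser_exists:
  assumes t: "0 \<le> t"
  shows "\<exists>x\<ge>0. \<forall>z\<ge>0. t * z - M z \<le> t * x - M x"
proof -
  have "\<forall>\<^sub>F z in at_top. t \<le> M z / z" using M_over_top by (simp add: filterlim_at_top)
  then obtain R where R: "\<And>z. R \<le> z \<Longrightarrow> t \<le> M z / z" by (auto simp: eventually_at_top_linorder)
  define R' where "R' = max R 1"
  have big: "t * z - M z \<le> 0" if "R' \<le> z" for z
    using R[of z] that by (simp add: R'_def field_simps)
  have "\<exists>x\<in>{0..R'}. \<forall>z\<in>{0..R'}. t * z - M z \<le> t * x - M x"
    by (intro continuous_attains_sup continuous_intros continuous_on_subset[OF M_continuous])
      (auto simp: R'_def)
  then obtain x where x: "0 \<le> x" "x \<le> R'" "\<And>z. 0 \<le> z \<Longrightarrow> z \<le> R' \<Longrightarrow> t * z - M z \<le> t * x - M x" by auto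
  have "0 \<le> t * x - M x" using x(3)[of 0] by (simp add: R'_def)
  then have "t * z - M z \<le> t * x - M x" if "0 \<le> z" for z
    using x(3)[OF that] big[of z] by linarith
  with x(1) show ?thesis by blast
qed

definition legendre_argmax :: "real \<Rightarrow> real" where
  "legendre_argmax t = (SOME x. 0 \<le> x \<and> (\<forall>z\<ge>0. t * z - M z \<le> t * x - M x))"

lemma legendre_argmax:
  assumes "0 \<le> t"
  shows legendre_argmax_nonneg: "0 \<le> legendre_argmax t"
    and legendre_argmax_max: "0 \<le> z \<Longrightarrow> t * z - M z \<le> t * legendre_argmax t - M (legendre_argmax t)"
proof -
  have "0 \<le> legendre_argmax t \<and> (\<forall>z\<ge>0. t * z - M z \<le> t * legendre_argmax t - M (legendre_argmax t))"
    unfolding legendre_argmax_def by (rule someI_ex) (use legendre_maximiser_exists[OF assms] in blast)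
  then show "0 \<le> legendre_argmax t" "0 \<le> z \<Longrightarrow> t * z - M z \<le> t * legendre_argmax t - M (legendre_argmax t)"
    by auto
qed

text \<open>
  Adding the two maximality conditions gives \<open>(t - s) (x\<^sub>t - x\<^sub>s) \<ge> 0\<close>. Monotonicity holds
  for every choice of maximisers; it makes the choice measurable and, up to countably many
  points, continuous.
\<close>

lemma legendre_argmax_mono:
  assumes "0 \<le> s" "s \<le> t"
  shows "legendre_argmax s \<le> legendre_argmax t"
proof (cases "s = t")
  case False
  let ?x = "legendre_argmax s" and ?y = "legendre_argmax t"
  have t: "0 \<le> t" using assms by simp
  have "s * ?y - M ?y \<le> s * ?x - M ?x" "t * ?x - M ?x \<le> t * ?y - M ?y"
    using assms t by (auto intro!: legendre_argmax_max legendre_argmax_nonneg)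
  then have "0 \<le> (t - s) * (?y - ?x)" by (simp add: algebra_simps)
  then show ?thesis using assms False by (simp add: zero_le_mult_iff)
qed auto

lemma complementary_le_argmax:
  assumes "0 \<le> t"
  shows "complementary M t \<le> t * legendre_argmax t - M (legendre_argmax t)"
  unfolding complementary_def
  using legendre_argmax_max[OF assms] by (intro cSUP_least) (auto simp: mult.commute)

end

section \<open>Integrals and local Sobolev functions on the half-line\<close>

lemma nn_integral_on_mono:
  fixes f :: "real \<Rightarrow> ennreal"
  assumes "A \<in> sets lebesgue" "B \<in> sets lebesgue" "A \<subseteq> B"
  shows "(\<integral>\<^sup>+x. f x \<partial>lebesgue_on A) \<le> (\<integral>\<^sup>+x. f x \<partial>lebesgue_on B)"
  using assms by (auto simp: nn_integral_restrict_space intro!: nn_integral_mono split: split_indicator)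

lemma nn_integral_on_exhaust:
  fixes f :: "real \<Rightarrow> ennreal"
  assumes inc: "incseq A" and A: "\<And>n. A n \<in> sets lebesgue"
    and f: "\<And>n. f \<in> borel_measurable (lebesgue_on (A n))"
    and le: "\<And>n. (\<integral>\<^sup>+x. f x \<partial>lebesgue_on (A n)) \<le> c"
  shows "(\<integral>\<^sup>+x. f x \<partial>lebesgue_on (\<Union>n. A n)) \<le> c"
proof -
  have sup: "(SUP n. f x * indicator (A n) x) = f x * indicator (\<Union>n. A n) x" for x
  proof (cases "x \<in> (\<Union>n. A n)")
    case True
    then obtain n where "x \<in> A n" by blast
    then have "f x \<le> (SUP n. f x * indicator (A n) x)" by (intro SUP_upper2[of n]) auto
    moreover have "(SUP n. f x * indicator (A n) x) \<le> f x"
      by (intro SUP_least) (auto split: split_indicator)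
    ultimately show ?thesis using True by auto
  qed auto
  have "(\<integral>\<^sup>+x. f x \<partial>lebesgue_on (\<Union>n. A n)) = (\<integral>\<^sup>+x. (SUP n. f x * indicator (A n) x) \<partial>lebesgue)"
    using A by (subst nn_integral_restrict_space) (auto simp: sup)
  also have "\<dots> = (SUP n. \<integral>\<^sup>+x. f x * indicator (A n) x \<partial>lebesgue)"
  proof (rule nn_integral_monotone_convergence_SUP)
    show "incseq (\<lambda>n x. f x * indicator (A n) x)"
    proof (intro incseq_SucI le_funI)
      fix n x
      have "A n \<subseteq> A (Suc n)" using inc by (rule incseq_SucD)
      then show "f x * indicator (A n) x \<le> f x * indicator (A (Suc n)) x"
        by (auto split: split_indicator)
    qed
  qed (use f A in \<open>auto simp: borel_measurable_restrict_space_iff_ennreal\<close>)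
  also have "\<dots> \<le> c"
    using le A by (intro SUP_least) (auto simp: nn_integral_restrict_space)
  finally show ?thesis .
qed

lemma nn_integral_on_vanish_at_0:
  fixes f :: "real \<Rightarrow> ennreal"
  assumes f: "f \<in> borel_measurable (lebesgue_on {0<..})"
    and fin: "(\<integral>\<^sup>+x. f x \<partial>lebesgue_on {0<..}) < \<infinity>" and e: "0 < e"
  obtains r where "0 < r" "(\<integral>\<^sup>+x. f x \<partial>lebesgue_on {0<..<r}) < e"
proof -
  let ?A = "\<lambda>n::nat. {0<..<1 / real (Suc n)}"
  let ?g = "\<lambda>n x. f x * indicator (?A n) x"
  have m: "?g n \<in> borel_measurable lebesgue" for n
  proof -
    have "(\<lambda>x. f x * indicator {0<..} x) \<in> borel_measurable lebesgue"
      using f by (simp add: borel_measurable_restrict_space_iff_ennreal)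
    then have "(\<lambda>x. (f x * indicator {0<..} x) * indicator (?A n) x) \<in> borel_measurable lebesgue"
      by (rule borel_measurable_times_ennreal) (intro borel_measurable_indicator, simp)
    also have "(\<lambda>x. (f x * indicator {0<..} x) * indicator (?A n) x) = ?g n"
      by (auto simp: fun_eq_iff split: split_indicator)
    finally show ?thesis .
  qed
  have zero: "(INF n. ?g n x) = 0" for x
  proof -
    have "\<exists>n. ?g n x = 0"
    proof (cases "0 < x")
      case True
      then obtain n where "1 / real (Suc n) < x" by (metis nat_approx_posE)
      then show ?thesis by (intro exI[of _ n]) auto
    qed auto
    then obtain n where n: "?g n x = 0" by blast
    have "(INF n. ?g n x) \<le> ?g n x" by (rule INF_lower) simp
    then show ?thesis unfolding n by simp
  qed
  have "0 = (\<integral>\<^sup>+x. (INF n. ?g n x) \<partial>lebesgue)" unfolding zero by simp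
  also have "\<dots> = (INF n. \<integral>\<^sup>+x. ?g n x \<partial>lebesgue)"
  proof (rule nn_integral_monotone_convergence_INF_decseq[where f="?g" and i=0])
    show "decseq ?g"
    proof (intro decseq_SucI le_funI)
      fix n x
      have "1 / real (Suc (Suc n)) \<le> 1 / real (Suc n)" by (intro divide_left_mono) auto
      then have "?A (Suc n) \<subseteq> ?A n" by auto
      then show "?g (Suc n) x \<le> ?g n x" by (auto split: split_indicator)
    qed
    have "(\<integral>\<^sup>+x. ?g 0 x \<partial>lebesgue) \<le> (\<integral>\<^sup>+x. f x * indicator {0<..} x \<partial>lebesgue)"
      by (intro nn_integral_mono) (auto split: split_indicator)
    also have "\<dots> < \<infinity>" using fin by (simp add: nn_integral_restrict_space)
    finally show "(\<integral>\<^sup>+x. ?g 0 x \<partial>lebesgue) < \<infinity>" .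
  qed (rule m)
  finally have "(INF n. \<integral>\<^sup>+x. ?g n x \<partial>lebesgue) < e" using e by simp
  then obtain n where "(\<integral>\<^sup>+x. ?g n x \<partial>lebesgue) < e" by (auto simp: INF_less_iff)
  then show thesis
    by (intro that[of "1 / real (Suc n)"]) (auto simp: nn_integral_restrict_space)
qed

lemma Union_Icc_exhausts_Ioi: "(\<Union>n::nat. {1 / real (Suc n)..real (Suc n)}) = {0<..}"
proof (intro set_eqI iffI)
  fix x :: real assume "x \<in> {0<..}"
  then have x: "0 < x" by simp
  obtain n where n: "1 / real (Suc n) < x" using x by (metis nat_approx_posE)
  obtain m where m: "x \<le> real m" using real_arch_simple by blast
  have "1 / real (Suc (max n m)) \<le> 1 / real (Suc n)" by (intro divide_left_mono) auto
  then show "x \<in> (\<Union>n. {1 / real (Suc n)..real (Suc n)})"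
    using n m by (intro UN_I[of "max n m"]) auto
qed (auto intro: less_le_trans[rotated])

lemma C1_deriv:
  fixes g :: "real \<Rightarrow> real"
  assumes "g C1_differentiable_on {0<..}"
  shows C1_has_deriv: "0 < r \<Longrightarrow> (g has_real_derivative deriv g r) (at r)"
    and C1_continuous_deriv: "continuous_on {0<..} (deriv g)"
    and C1_continuous: "continuous_on {0<..} g"
proof -
  obtain g' where g': "\<And>x. x \<in> {0<..} \<Longrightarrow> (g has_real_derivative g' x) (at x)" "continuous_on {0<..} g'"
    using assms unfolding C1_differentiable_on_def has_real_derivative_iff_has_vector_derivative by blast
  have eq: "deriv g r = g' r" if "0 < r" for r
    using g'(1)[of r] that by (simp add: DERIV_imp_deriv)
  show "0 < r \<Longrightarrow> (g has_real_derivative deriv g r) (at r)" using g'(1)[of r] eq by simp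
  show "continuous_on {0<..} (deriv g)" using g'(2) eq continuous_on_cong[OF refl, of "{0<..}" "deriv g" g'] by auto
  show "continuous_on {0<..} g"
    using g'(1) by (intro continuous_at_imp_continuous_on ballI) (metis DERIV_isCont)
qed

lemma C1_Lipschitz:
  fixes g g' :: "real \<Rightarrow> real"
  assumes g: "\<And>x. 0 < x \<Longrightarrow> (g has_real_derivative g' x) (at x)" and g': "continuous_on {0<..} g'"
    and "0 < a"
  obtains K where "0 \<le> K" "\<And>s t. s \<in> {a..b} \<Longrightarrow> t \<in> {a..b} \<Longrightarrow> \<bar>g t - g s\<bar> \<le> K * \<bar>t - s\<bar>"
proof -
  have "continuous_on {a..b} g'" by (rule continuous_on_subset[OF g']) (use \<open>0 < a\<close> in auto)
  then have "bounded (g' ` {a..b})" by (intro compact_imp_bounded compact_continuous_image) auto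
  then obtain K where K: "0 < K" "\<forall>x\<in>{a..b}. \<bar>g' x\<bar> \<le> K"
    by (auto simp: bounded_pos)
  show thesis
  proof (rule that[of K])
    fix s t assume st: "s \<in> {a..b}" "t \<in> {a..b}"
    have "norm (g t - g s) \<le> K * norm (t - s)"
      by (rule field_differentiable_bound[where S="{a..b}" and f'=g'])
        (use st \<open>0 < a\<close> K in \<open>auto intro: has_field_derivative_at_within[OF g]\<close>)
    then show "\<bar>g t - g s\<bar> \<le> K * \<bar>t - s\<bar>" by simp
  qed (use K in simp)
qed

lemma W11_loc_D:
  assumes u: "u \<in> W11_loc"
  shows W11_loc_abs_continuous: "0 < a \<Longrightarrow> abs_continuous_on a b u"
    and W11_loc_deriv: "0 < a \<Longrightarrow> AE x in lebesgue_on {a..b}. (u has_real_derivative deriv u x) (at x)"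
    and W11_loc_continuous: "continuous_on {0<..} u"
    and W11_loc_deriv_measurable: "deriv u \<in> borel_measurable (lebesgue_on {0<..})"
proof -
  show ac: "abs_continuous_on a b u" if "0 < a" for a b
  proof (cases "a \<le> b")
    case True
    then show ?thesis using u that by (auto simp: W11_loc_def)
  next
    case False
    show ?thesis
      by (rule abs_continuous_on_Lipschitz[of _ _ _ 0]) (use False in auto)
  qed
  have "AE x in lebesgue. x \<in> {0<..} \<longrightarrow> u differentiable (at x)"
    using u by (simp add: W11_loc_def AE_restrict_space_iff)
  then show "AE x in lebesgue_on {a..b}. (u has_real_derivative deriv u x) (at x)" if "0 < a" for a b
    using that by (auto simp: AE_restrict_space_iff DERIV_deriv_iff_real_differentiable elim!: eventually_mono)
  show "continuous_on {0<..} u"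
  proof (rule continuous_at_imp_continuous_on, rule ballI)
    fix x :: real assume "x \<in> {0<..}"
    then have x: "0 < x" by simp
    have "continuous_on {x / 2..2 * x} u"
      by (rule abs_continuous_on_imp_continuous_on[OF ac]) (use x in auto)
    then show "isCont u x" by (rule continuous_on_interior) (use x in \<open>auto simp: interior_atLeastAtMost_real\<close>)
  qed
  show "deriv u \<in> borel_measurable (lebesgue_on {0<..})"
  proof -
    let ?A = "\<lambda>n::nat. {1 / real (Suc n)..real (Suc n)}"
    have "deriv u \<in> borel_measurable (lebesgue_on (\<Union>n. ?A n))"
    proof (rule measurable_piecewise_restrict[of "range ?A"])
      show "deriv u \<in> borel_measurable (restrict_space (lebesgue_on (\<Union>n. ?A n)) X)" if X: "X \<in> range ?A" for X
      proof -
        obtain n where n: "X = ?A n" using X by auto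
        have "1 / real (Suc n) \<le> real (Suc n)" by (simp add: field_simps)
        then have "set_integrable lebesgue (?A n) (deriv u)" using u by (auto simp: W11_loc_def)
        then have "integrable (lebesgue_on (?A n)) (deriv u)"
          by (subst integrable_restrict_space) (auto simp: set_integrable_def)
        moreover have "restrict_space (lebesgue_on (\<Union>n. ?A n)) X = lebesgue_on (?A n)"
          unfolding n by (subst restrict_restrict_space) (auto intro!: arg_cong[where f="restrict_space lebesgue"])
        ultimately show ?thesis by auto
      qed
    qed (auto simp: sets_restrict_space)
    moreover note Union_Icc_exhausts_Ioi
    ultimately show ?thesis by simp
  qed
qed

lemma W11_loc_increment_le:
  assumes u: "u \<in> W11_loc" and ab: "0 < a" "a \<le> b"
  shows "ennreal \<bar>u b - u a\<bar> \<le> (\<integral>\<^sup>+x. ennreal \<bar>deriv u x\<bar> \<partial>lebesgue_on {a..b})"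
proof -
  have m: "(\<lambda>x. \<bar>deriv u x\<bar>) \<in> borel_measurable (lebesgue_on {a..b})"
  proof (rule borel_measurable_abs, rule measurable_restrict_mono[OF W11_loc_deriv_measurable[OF u]])
  qed (use ab in auto)
  have "ennreal (u b - u a) \<le> (\<integral>\<^sup>+x. ennreal \<bar>deriv u x\<bar> \<partial>lebesgue_on {a..b})"
    using W11_loc_deriv[OF u ab(1), of b] m
    by (intro abs_continuous_increment_le ab W11_loc_abs_continuous[OF u])
      (auto elim!: eventually_mono intro: exI[of _ "deriv u _"])
  moreover have "ennreal ((- u b) - (- u a)) \<le> (\<integral>\<^sup>+x. ennreal \<bar>deriv u x\<bar> \<partial>lebesgue_on {a..b})"
    using W11_loc_deriv[OF u ab(1), of b] m
    by (intro abs_continuous_increment_le[where h="\<lambda>x. - u x"] ab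
         abs_continuous_on_dominated[OF W11_loc_abs_continuous[OF u ab(1)], where K=1])
      (auto elim!: eventually_mono intro!: exI[of _ "- deriv u _"] DERIV_minus)
  ultimately show ?thesis by (cases "u a \<le> u b") auto
qed

lemma monotone_integrable_on:
  fixes g :: "real \<Rightarrow> real"
  assumes "mono_on {a..c} g \<or> mono_on {a..c} (\<lambda>x. - g x)"
  shows "g integrable_on {a..c}"
proof (cases "mono_on {a..c} g")
  case False
  then have "(\<lambda>x. - (- g x)) integrable_on {a..c}"
    using assms by (intro integrable_neg integrable_on_mono_on) auto
  then show ?thesis by simp
qed (rule integrable_on_mono_on)

lemma integral_monotone_eq_nn_integral:
  fixes g :: "real \<Rightarrow> real"
  assumes mono: "mono_on {a..c} g \<or> mono_on {a..c} (\<lambda>x. - g x)"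
    and g0: "\<And>x. x \<in> {a..c} \<Longrightarrow> 0 \<le> g x"
  shows "ennreal (integral {a..c} g) = (\<integral>\<^sup>+x. ennreal (g x) \<partial>lebesgue_on {a..c})"
proof -
  have gi: "integrable (lebesgue_on {a..c}) g"
    using nonnegative_absolutely_integrable_1[OF monotone_integrable_on[OF mono] g0]
    by (subst integrable_restrict_space) (auto simp: set_integrable_def)
  have "AE x in lebesgue_on {a..c}. 0 \<le> g x" by (rule AE_I2) (simp add: g0)
  then show ?thesis
    using nn_integral_eq_integral[OF gi] lebesgue_integral_eq_integral[OF gi] by simp
qed

text \<open>
  Monotone integrands are enough for the test functions below, and they avoid Lebesgue's
  differentiation theorem: the derivative of the primitive is the integrand outside the countable
  set of its discontinuities.
\<close>

lemma primitive_of_monotone: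
  fixes g :: "real \<Rightarrow> real"
  assumes a: "0 < a" "a < c" and mono: "mono_on {a..c} g \<or> mono_on {a..c} (\<lambda>x. - g x)"
    and g0: "\<And>x. x \<in> {a..c} \<Longrightarrow> 0 \<le> g x"
  obtains u where "u \<in> hardy_transforms"
    and "AE x in lebesgue_on {0<..}. deriv u x = (if x \<in> {a..c} then g x else 0)"
    and "\<And>x. c \<le> x \<Longrightarrow> u x = integral {a..c} g"
proof -
  define G where "G x = (if x \<in> {a..c} then g x else 0)" for x
  define u where "u x = integral {0..x} G" for x
  \<comment> \<open>a bound for \<open>g\<close>, whichever way it is monotone\<close>
  define B where "B = max (g a) (g c)"
  note g_int = monotone_integrable_on[OF mono]
  have B: "\<bar>G x\<bar> \<le> B" for x
  proof (cases "x \<in> {a..c}")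
    case True
    then have "g x \<le> B" using mono a by (auto simp: B_def mono_on_def le_max_iff_disj)
    then show ?thesis using True g0 by (auto simp: G_def)
  next
    case False
    have "0 \<le> B" using g0[of a] a by (auto simp: B_def le_max_iff_disj)
    then show ?thesis using False by (auto simp: G_def)
  qed
  have G0: "0 \<le> G x" for x using g0 by (simp add: G_def)
  have "G integrable_on UNIV"
    unfolding G_def by (simp add: integrable_restrict_UNIV g_int del: atLeastAtMost_iff)
  then have G_int: "G integrable_on {s..t}" for s t
    by (rule integrable_on_subinterval) auto
  have G_abs: "G absolutely_integrable_on {s..t}" for s t
    using G_int G0 by (intro nonnegative_absolutely_integrable_1) auto
  have u_diff: "u t - u s = integral {s..t} G" if "0 \<le> s" "s \<le> t" for s t
    unfolding u_def using Henstock_Kurzweil_Integration.integral_combine[OF that G_int] by simp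
  have u_Lip: "\<bar>u t - u s\<bar> \<le> B * (t - s)" if "0 \<le> s" "s \<le> t" for s t
  proof -
    have "norm (integral {s..t} G) \<le> B * measure lborel {s..t}"
      using B order_trans[OF abs_ge_zero B[of 0]] by (intro has_integral_bound_real[OF _ finite.emptyI integrable_integral[OF G_int]]) auto
    then show ?thesis using that by (simp add: u_diff)
  qed
  define D where "D = {x \<in> {a<..<c}. \<not> isCont g x}"
  have D_count: "countable D"
  proof (cases "mono_on {a..c} g")
    case True
    then have "mono_on {a<..<c} g" by (rule mono_on_subset) auto
    then show ?thesis unfolding D_def by (rule mono_on_ctble_discont_open[rotated]) auto
  next
    case False
    then have "mono_on {a..c} (\<lambda>x. - g x)" using mono by simp
    then have "mono_on {a<..<c} (\<lambda>x. - g x)" by (rule mono_on_subset) auto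
    then have "countable {x \<in> {a<..<c}. \<not> isCont (\<lambda>x. - g x) x}"
      by (rule mono_on_ctble_discont_open[rotated]) auto
    moreover have "isCont (\<lambda>x. - g x) x \<longleftrightarrow> isCont g x" for x
      using continuous_minus[of "at x" g] continuous_minus[of "at x" "\<lambda>x. - g x"] by auto
    ultimately show ?thesis by (simp add: D_def)
  qed
  define Z where "Z = D \<union> {a, c}"
  have Z_neg: "negligible Z" using D_count
    by (simp add: Z_def negligible_iff_null_sets null_sets_completionI countable_imp_null_set_lborel)
  have G_cont: "isCont G x" if "x \<notin> Z" for x
  proof -
    have "x \<noteq> a" "x \<noteq> c" using that by (auto simp: Z_def)
    then consider "x < a" | "c < x" | "a < x" "x < c" by linarith
    then show ?thesis
    proof cases
      case 1
      then have "\<forall>\<^sub>F y in nhds x. y \<in> {..<a}" by (intro eventually_nhds_in_open) auto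
      then have "\<forall>\<^sub>F y in nhds x. G y = 0" by eventually_elim (auto simp: G_def)
      then show ?thesis using isCont_cong by fastforce
    next
      case 2
      then have "\<forall>\<^sub>F y in nhds x. y \<in> {c<..}" by (intro eventually_nhds_in_open) auto
      then have "\<forall>\<^sub>F y in nhds x. G y = 0" by eventually_elim (auto simp: G_def)
      then show ?thesis using isCont_cong by fastforce
    next
      case 3
      then have "\<forall>\<^sub>F y in nhds x. y \<in> {a<..<c}" by (intro eventually_nhds_in_open) auto
      then have "\<forall>\<^sub>F y in nhds x. G y = g y" by eventually_elim (auto simp: G_def)
      moreover have "isCont g x" using 3 that by (auto simp: Z_def D_def)
      ultimately show ?thesis using isCont_cong by blast
    qed
  qed
  have u_der: "(u has_real_derivative G x) (at x)" if "0 < x" "x \<notin> Z" for x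
  proof -
    have "((\<lambda>y. integral {0..y} G) has_vector_derivative G x) (at x within ({0..x + 1} - {}))"
      using that G_cont[of x]
      by (intro integral_has_vector_derivative_continuous_at G_int)
        (auto intro: continuous_at_imp_continuous_at_within)
    then have "(u has_real_derivative G x) (at x within {0..x + 1})"
      unfolding u_def [abs_def] by (simp add: has_real_derivative_iff_has_vector_derivative)
    then show ?thesis using that by (simp add: at_within_Icc_at)
  qed
  have AE_Z: "AE x in lebesgue_on {0<..}. 0 < x \<and> x \<notin> Z"
    using AE_not_in[of Z lebesgue] Z_neg
    by (auto simp: AE_restrict_space_iff negligible_iff_null_sets elim: eventually_mono)
  have der_eq: "deriv u x = G x" if "0 < x" "x \<notin> Z" for x
    using u_der[OF that] by (rule DERIV_imp_deriv)
  have W: "u \<in> W11_loc"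
    unfolding W11_loc_def
  proof (intro CollectI conjI allI impI)
    fix s t :: real assume "0 < s \<and> s \<le> t"
    then have st: "0 < s" "s \<le> t" by auto
    show "abs_continuous_on s t u"
      by (rule abs_continuous_on_Lipschitz[of _ _ _ B]) (use u_Lip st in auto)
    show "set_integrable lebesgue {s..t} (deriv u)"
      by (rule absolutely_integrable_spike[OF G_abs Z_neg]) (use st der_eq in auto)
  next
    show "AE x in lebesgue_on {0<..}. u differentiable at x"
      using AE_Z by eventually_elim (use u_der in \<open>auto simp: real_differentiable_def\<close>)
  qed
  show thesis
  proof (rule that[of u])
    have "\<forall>\<^sub>F x in at_right 0. x \<in> {0<..<a}" using a(1) by (rule eventually_at_right_real)
    then have "\<forall>\<^sub>F x in at_right 0. 0 = u x"
    proof eventually_elim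
      case (elim x)
      have "integral {0..x} G = integral {0..x} (\<lambda>_. 0)"
        by (rule integral_cong) (use elim in \<open>auto simp: G_def\<close>)
      then show ?case by (simp add: u_def)
    qed
    then have "(u \<longlongrightarrow> 0) (at_right 0)" by (rule Lim_transform_eventually[OF tendsto_const])
    with W show "u \<in> hardy_transforms" by (simp add: hardy_transforms_def)
    show "AE x in lebesgue_on {0<..}. deriv u x = (if x \<in> {a..c} then g x else 0)"
      using AE_Z by eventually_elim (use der_eq in \<open>auto simp: G_def\<close>)
    show "u x = integral {a..c} g" if "c \<le> x" for x
    proof -
      have "{0..x} \<inter> {a..c} = {a..c}" using that a by auto
      moreover have "u x = integral ({0..x} \<inter> {a..c}) g"
        unfolding u_def G_def by (subst Int_commute) (rule integral_restrict_Int)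
      ultimately show ?thesis by (simp only:)
    qed
  qed
qed

section \<open>The differential inequality for the energy\<close>

text \<open>
  The two cases of the theorem in one form: \<open>\<sigma>\<close> is the sign of \<open>\<phi>'\<close>, and \<open>b_le\<close> is the positivity of
  \<open>b\<^sub>1\<close> or \<open>b\<^sub>2\<close>. In these constants the indicator functions select, according to the sign
  of \<open>\<omega>' \<phi>'\<close>, the exponent in \<open>[d, D]\<close> that makes the expression smallest; requiring the bound for
  all exponents in that range is therefore the same.
\<close>

locale weighted_hardy = growth_function +
  fixes \<phi> \<omega> :: "real \<Rightarrow> real" and \<sigma> b L :: real
  assumes phi_C1: "\<phi> C1_differentiable_on {0<..}"
    and dphi_C1: "deriv \<phi> C1_differentiable_on {0<..}"
    and omega_nonneg: "\<And>r. 0 < r \<Longrightarrow> 0 \<le> \<omega> r"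
    and omega_C1: "\<omega> C1_differentiable_on {0<..}"
    and A_finite: "\<forall>\<^sub>F r in at_right 0. A_phi M d D \<phi> r < \<infinity>"
    and K_bounded: "Bfun (K_fun M d D \<phi> \<omega>) (at_right 0)"
    and sigma: "\<bar>\<sigma>\<bar> = 1"
    and dphi_sign: "\<And>r. 0 < r \<Longrightarrow> 0 < \<sigma> * deriv \<phi> r"
    and b_pos: "0 < b" and L_pos: "0 < L"
    and b_le: "\<And>r p. 0 < r \<Longrightarrow> d \<le> p \<Longrightarrow> p \<le> D \<Longrightarrow>
       b \<le> \<sigma> * (1 + deriv (deriv \<phi>) r / (deriv \<phi> r)\<^sup>2 - p * (deriv \<omega> r / (\<omega> r * deriv \<phi> r)))"
    and omega_le: "\<And>r. 0 < r \<Longrightarrow> \<omega> r \<le> L * \<bar>deriv \<phi> r\<bar>"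
begin

definition weight :: "real \<Rightarrow> real" where
  "weight r = \<sigma> * exp (- \<phi> r) / deriv \<phi> r"

definition weight_deriv :: "real \<Rightarrow> real" where
  "weight_deriv r = - (\<sigma> * exp (- \<phi> r) * (1 + deriv (deriv \<phi>) r / (deriv \<phi> r)\<^sup>2))"

lemma dphi_abs: "0 < r \<Longrightarrow> \<bar>deriv \<phi> r\<bar> = \<sigma> * deriv \<phi> r"
  using dphi_sign[of r] sigma by (metis abs_mult abs_of_pos mult_1)

lemma dphi_nz: "0 < r \<Longrightarrow> deriv \<phi> r \<noteq> 0"
  using dphi_sign[of r] by auto

lemma weight_eq: "0 < r \<Longrightarrow> weight r = exp (- \<phi> r) / \<bar>deriv \<phi> r\<bar>"
proof -
  assume r: "0 < r"
  have "\<sigma> = 1 \<or> \<sigma> = - 1" using sigma by auto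
  then show ?thesis unfolding weight_def dphi_abs[OF r] by auto
qed

lemma weight_pos: "0 < r \<Longrightarrow> 0 < weight r"
  using dphi_nz[of r] by (simp add: weight_eq)

lemma weight_has_deriv: "0 < r \<Longrightarrow> (weight has_real_derivative weight_deriv r) (at r)"
  unfolding weight_def [abs_def] weight_deriv_def using dphi_nz[of r]
  by (auto intro!: derivative_eq_intros C1_has_deriv[OF phi_C1] C1_has_deriv[OF dphi_C1]
       simp: field_simps power2_eq_square)

lemma weight_deriv_continuous: "continuous_on {0<..} weight_deriv"
  unfolding weight_deriv_def [abs_def] using dphi_nz
  by (intro continuous_intros C1_continuous[OF phi_C1] C1_continuous_deriv[OF phi_C1]
       C1_continuous_deriv[OF dphi_C1]) auto

definition energy :: "(real \<Rightarrow> real) \<Rightarrow> real \<Rightarrow> real" where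
  "energy u r = M \<bar>\<omega> r * u r\<bar> * weight r"

text \<open>
  The parameter of the Young-type inequality for which the term that has to be absorbed is at most
  \<open>b / 2\<close> times the gain.
\<close>

definition young_eps where "young_eps = min 1 (b / (2 * D * L))"
definition energy_const where "energy_const = D * L * (1 / young_eps) powr D"

lemma D_pos: "0 < D" using d_ge d_le_D by linarith

lemma young_param: "0 < young_eps" "young_eps \<le> 1" "D * L * young_eps \<le> b / 2"
proof -
  show "0 < young_eps" "young_eps \<le> 1" using b_pos L_pos D_pos by (auto simp: young_eps_def)
  have "D * L * young_eps \<le> D * L * (b / (2 * D * L))"
    using L_pos D_pos by (intro mult_left_mono) (auto simp: young_eps_def)
  also have "\<dots> = b / 2" using L_pos D_pos by simp
  finally show "D * L * young_eps \<le> b / 2" .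
qed

lemma energy_const_pos: "0 < energy_const"
  using young_param D_pos L_pos by (simp add: energy_const_def)

text \<open>
  The local growth exponent \<open>p = s M' s / M s\<close>. If \<open>M s = 0\<close> then \<open>M' s = 0\<close>
  and any exponent in the range serves.
\<close>

lemma deriv_M_exponent:
  assumes "0 < s"
  obtains p where "d \<le> p" "p \<le> D" "s * deriv M s = p * M s"
proof (cases "M s = 0")
  case True
  then have "deriv M s = 0" using growth assms by fastforce
  then show thesis using True d_le_D by (intro that[of d]) auto
next
  case False
  then have Ms: "0 < M s" using M_nonneg[of s] assms by simp
  have g: "d * (M s / s) \<le> deriv M s" "deriv M s \<le> D * (M s / s)" using growth assms by auto
  show thesis
  proof (rule that[of "s * deriv M s / M s"])
    show "d \<le> s * deriv M s / M s" "s * deriv M s / M s \<le> D"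
      using g assms Ms by (auto simp: field_simps)
  qed (use Ms in simp)
qed

text \<open>
  By the product rule the terms without \<open>u'\<close> combine to
  \<open>- M s e\<^sup>-\<^sup>\<phi> \<cdot> \<sigma> (1 + \<phi>'' / \<phi>'\<^sup>2 - p \<omega>' / (\<omega> \<phi>'))\<close> with \<open>s = \<bar>\<omega> u\<bar>\<close> and the local growth exponent
  \<open>p\<close> at \<open>s\<close>; this is at most \<open>- b M s e\<^sup>-\<^sup>\<phi>\<close>. The term with \<open>u'\<close> is bounded by
  \<open>D L (M s / s) \<bar>u'\<bar> e\<^sup>-\<^sup>\<phi>\<close>, and after the Young-type inequality this costs at most
  half of the gain plus a multiple of \<open>M \<bar>u'\<bar> e\<^sup>-\<^sup>\<phi>\<close>. Where \<open>s = 0\<close> the derivative of the energy vanishes.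
\<close>

lemma energy_deriv:
  assumes x: "0 < x" and u: "(u has_real_derivative u') (at x)"
  shows "\<exists>l. (energy u has_real_derivative l) (at x) \<and>
     l \<le> energy_const * (M \<bar>u'\<bar> * exp (- \<phi> x)) - b / 2 * (M \<bar>\<omega> x * u x\<bar> * exp (- \<phi> x))"
proof -
  define s where "s = \<bar>\<omega> x * u x\<bar>"
  define \<omega>' where "\<omega>' = deriv \<omega> x"
  define E where "E = exp (- \<phi> x)"
  have E: "0 < E" by (simp add: E_def)
  define l where "l = even_deriv (\<omega> x * u x) * (\<omega>' * u x + \<omega> x * u') * weight x + M s * weight_deriv x"
  have der: "(energy u has_real_derivative l) (at x)"
    unfolding energy_def [abs_def] l_def s_def \<omega>'_def
    by (auto intro!: derivative_eq_intros DERIV_chain2[OF M_abs_deriv] C1_has_deriv[OF omega_C1] weight_has_deriv x u)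
  have "l \<le> energy_const * (M \<bar>u'\<bar> * E) - b / 2 * (M s * E)"
  proof (cases "s = 0")
    case True
    then have "l = 0" by (auto simp: l_def s_def even_deriv_def)
    then show ?thesis using True energy_const_pos M_nonneg E by simp
  next
    case False
    then have s: "0 < s" and ux: "u x \<noteq> 0" "\<omega> x \<noteq> 0" by (auto simp: s_def)
    with omega_nonneg[OF x] have om: "0 < \<omega> x" by simp
    have s_eq: "s = \<omega> x * \<bar>u x\<bar>" using om by (simp add: s_def abs_mult)
    have dM_eq: "even_deriv (\<omega> x * u x) = sgn (u x) * deriv M s"
      using ux om by (simp add: even_deriv_def s_def sgn_mult)
    obtain p where p: "d \<le> p" "p \<le> D" "s * deriv M s = p * M s"
      using deriv_M_exponent[OF s] .
    have "even_deriv (\<omega> x * u x) * (\<omega>' * u x) = deriv M s * \<bar>u x\<bar> * \<omega>'"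
      unfolding dM_eq by (simp add: abs_sgn mult_ac)
    also have "\<dots> = s * deriv M s * \<omega>' / \<omega> x" using om by (simp add: s_eq)
    finally have t1: "even_deriv (\<omega> x * u x) * (\<omega>' * u x) = p * M s * \<omega>' / \<omega> x" using p by simp
    have "even_deriv (\<omega> x * u x) * (\<omega>' * u x) * weight x + M s * weight_deriv x =
        - (M s * E) * (\<sigma> * (1 + deriv (deriv \<phi>) x / (deriv \<phi> x)\<^sup>2 - p * (\<omega>' / (\<omega> x * deriv \<phi> x))))"
      unfolding t1 weight_def weight_deriv_def E_def using om dphi_nz[OF x] by (simp add: field_simps power2_eq_square)
    also have "\<dots> \<le> - (M s * E) * b"
      using b_le[OF x p(1,2)] M_nonneg[of s] s E by (intro mult_left_mono_neg) (auto simp: \<omega>'_def)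
    finally have part1: "even_deriv (\<omega> x * u x) * (\<omega>' * u x) * weight x + M s * weight_deriv x \<le> - (M s * E) * b" .
    have oq: "\<omega> x * weight x \<le> L * E"
    proof -
      have "\<omega> x * weight x \<le> L * \<bar>deriv \<phi> x\<bar> * weight x"
        using omega_le[OF x] weight_pos[OF x] by (intro mult_right_mono) auto
      also have "\<dots> = L * E" using dphi_nz[OF x] by (simp add: weight_eq[OF x] E_def)
      finally show ?thesis .
    qed
    have "even_deriv (\<omega> x * u x) * (\<omega> x * u') * weight x \<le> \<bar>even_deriv (\<omega> x * u x)\<bar> * \<bar>u'\<bar> * (\<omega> x * weight x)"
    proof -
      have "even_deriv (\<omega> x * u x) * (\<omega> x * u') * weight x = (even_deriv (\<omega> x * u x) * u') * (\<omega> x * weight x)" by simp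
      also have "\<dots> \<le> \<bar>even_deriv (\<omega> x * u x) * u'\<bar> * (\<omega> x * weight x)"
        using om weight_pos[OF x] by (intro mult_right_mono) auto
      finally show ?thesis by (simp add: abs_mult)
    qed
    also have "\<dots> \<le> (D * (M s / s)) * \<bar>u'\<bar> * (L * E)"
    proof (rule mult_mono[OF _ oq])
      show "\<bar>even_deriv (\<omega> x * u x)\<bar> * \<bar>u'\<bar> \<le> D * (M s / s) * \<bar>u'\<bar>"
        unfolding s_def by (intro mult_right_mono even_deriv_bound) auto
    qed (use om weight_pos[OF x] M_nonneg[of s] s D_pos in auto)
    also have "\<dots> = D * L * E * (M s / s * \<bar>u'\<bar>)" by simp
    also have "\<dots> \<le> D * L * E * (young_eps * M s + (1 / young_eps) powr D * M \<bar>u'\<bar>)"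
      using s D_pos L_pos E young_param by (intro mult_left_mono M_young) auto
    also have "\<dots> = (D * L * young_eps) * (E * M s) + energy_const * (M \<bar>u'\<bar> * E)"
      by (simp add: energy_const_def algebra_simps)
    also have "\<dots> \<le> b / 2 * (E * M s) + energy_const * (M \<bar>u'\<bar> * E)"
      using young_param(3) E M_nonneg[of s] s by (intro add_right_mono mult_right_mono) auto
    finally show ?thesis using part1 unfolding l_def by (simp add: algebra_simps)
  qed
  then show ?thesis using der by (auto simp: s_def E_def)
qed

text \<open>
  On a compact interval away from the origin all factors of the energy are bounded and, except for
  \<open>u\<close> itself, Lipschitz.
\<close>

lemma energy_abs_continuous:
  assumes u: "u \<in> W11_loc" and a: "0 < a"
  shows "abs_continuous_on a c (energy u)"
proof -
  have cu: "continuous_on {a..c} u"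
    by (rule continuous_on_subset[OF W11_loc_continuous[OF u]]) (use a in auto)
  have co: "continuous_on {a..c} \<omega>"
    by (rule continuous_on_subset[OF C1_continuous[OF omega_C1]]) (use a in auto)
  have cq: "continuous_on {a..c} weight"
    by (intro continuous_at_imp_continuous_on ballI) (use a in \<open>auto intro!: DERIV_isCont[OF weight_has_deriv]\<close>)
  have "bounded (u ` {a..c})" "bounded (\<omega> ` {a..c})" "bounded (weight ` {a..c})"
    "bounded ((\<lambda>x. M \<bar>\<omega> x * u x\<bar>) ` {a..c})"
    using cu co cq
    by (auto intro!: compact_imp_bounded compact_continuous_image continuous_intros
       continuous_on_compose2[OF M_abs_continuous])
  then obtain U W Q B where
      U: "0 < U" "\<forall>x\<in>{a..c}. \<bar>u x\<bar> \<le> U" and W: "0 < W" "\<forall>x\<in>{a..c}. \<bar>\<omega> x\<bar> \<le> W"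
      and Q: "0 < Q" "\<forall>x\<in>{a..c}. \<bar>weight x\<bar> \<le> Q"
      and B: "0 < B" "\<forall>x\<in>{a..c}. \<bar>M \<bar>\<omega> x * u x\<bar>\<bar> \<le> B"
    by (auto simp: bounded_pos)
  obtain Kq where Kq: "0 \<le> Kq" "\<And>s t. s \<in> {a..c} \<Longrightarrow> t \<in> {a..c} \<Longrightarrow> \<bar>weight t - weight s\<bar> \<le> Kq * \<bar>t - s\<bar>"
    using C1_Lipschitz[OF weight_has_deriv weight_deriv_continuous a] by blast
  obtain Kw where Kw: "0 \<le> Kw" "\<And>s t. s \<in> {a..c} \<Longrightarrow> t \<in> {a..c} \<Longrightarrow> \<bar>\<omega> t - \<omega> s\<bar> \<le> Kw * \<bar>t - s\<bar>"
    using C1_Lipschitz[OF C1_has_deriv[OF omega_C1] C1_continuous_deriv[OF omega_C1] a] by blast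
  define V where "V = W * U"
  define J where "J = D * (M V / V)"
  have J: "0 \<le> J" using D_pos U(1) W(1) M_nonneg[of V] by (simp add: J_def V_def)
  show ?thesis
  proof (rule abs_continuous_on_dominated[OF W11_loc_abs_continuous[OF u a], where K="J * W * Q + J * U * Kw * Q + B * Kq"])
    fix s t assume st: "a \<le> s" "s \<le> t" "t \<le> c"
    then have i: "s \<in> {a..c}" "t \<in> {a..c}" by auto
    have V: "\<bar>\<omega> s * u s\<bar> \<le> V" "\<bar>\<omega> t * u t\<bar> \<le> V"
      unfolding V_def abs_mult using U W i by (auto intro!: mult_mono)
    have "\<omega> t * u t - \<omega> s * u s = \<omega> t * (u t - u s) + (\<omega> t - \<omega> s) * u s" by (simp add: algebra_simps)
    then have "\<bar>\<omega> t * u t - \<omega> s * u s\<bar> \<le> \<bar>\<omega> t\<bar> * \<bar>u t - u s\<bar> + \<bar>\<omega> t - \<omega> s\<bar> * \<bar>u s\<bar>"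
      by (metis abs_mult abs_triangle_ineq)
    also have "\<dots> \<le> W * \<bar>u t - u s\<bar> + Kw * \<bar>t - s\<bar> * U"
      using W U i Kw by (intro add_mono mult_mono) auto
    finally have 1: "\<bar>\<omega> t * u t - \<omega> s * u s\<bar> \<le> W * \<bar>u t - u s\<bar> + Kw * U * (t - s)"
      using st by (simp add: mult_ac)
    have "\<bar>M \<bar>\<omega> t * u t\<bar> - M \<bar>\<omega> s * u s\<bar>\<bar> \<le> J * \<bar>\<omega> t * u t - \<omega> s * u s\<bar>"
      unfolding J_def by (rule M_abs_Lipschitz[OF V])
    also have "\<dots> \<le> J * (W * \<bar>u t - u s\<bar> + Kw * U * (t - s))"
      by (rule mult_left_mono[OF 1 J])
    finally have 2: "\<bar>M \<bar>\<omega> t * u t\<bar> - M \<bar>\<omega> s * u s\<bar>\<bar> \<le> J * (W * \<bar>u t - u s\<bar> + Kw * U * (t - s))" .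
    have 3: "\<bar>weight t - weight s\<bar> \<le> Kq * (t - s)" using Kq(2)[OF i] st by simp
    have "energy u t - energy u s = (M \<bar>\<omega> t * u t\<bar> - M \<bar>\<omega> s * u s\<bar>) * weight t + M \<bar>\<omega> s * u s\<bar> * (weight t - weight s)"
      by (simp add: energy_def algebra_simps)
    then have "\<bar>energy u t - energy u s\<bar> \<le>
        \<bar>M \<bar>\<omega> t * u t\<bar> - M \<bar>\<omega> s * u s\<bar>\<bar> * \<bar>weight t\<bar> + \<bar>M \<bar>\<omega> s * u s\<bar>\<bar> * \<bar>weight t - weight s\<bar>"
      by (metis abs_mult abs_triangle_ineq)
    also have "\<dots> \<le> J * (W * \<bar>u t - u s\<bar> + Kw * U * (t - s)) * Q + B * (Kq * (t - s))"
      using 2 3 Q B Kq(1) i J W U Kw(1) st by (intro add_mono mult_mono) auto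
    also have "\<dots> = (J * W * Q) * \<bar>u t - u s\<bar> + (J * U * Kw * Q + B * Kq) * (t - s)"
      using st by (simp add: algebra_simps)
    also have "\<dots> \<le> (J * W * Q + J * U * Kw * Q + B * Kq) * \<bar>u t - u s\<bar> + (J * W * Q + J * U * Kw * Q + B * Kq) * (t - s)"
      using J W U Q Kw Kq B st by (intro add_mono mult_right_mono) (auto intro!: add_nonneg_nonneg mult_nonneg_nonneg)
    finally show "\<bar>energy u t - energy u s\<bar> \<le> (J * W * Q + J * U * Kw * Q + B * Kq) * (\<bar>u t - u s\<bar> + (t - s))"
      by (simp only: distrib_left)
  qed
qed

section \<open>Behaviour at the origin and the Hardy inequality\<close>

definition mod_integral :: "(real \<Rightarrow> real) \<Rightarrow> real set \<Rightarrow> ennreal" where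
  "mod_integral v S = (\<integral>\<^sup>+x. ennreal (M \<bar>v x\<bar> * exp (- \<phi> x)) \<partial>lebesgue_on S)"

lemma phi_measurable: "S \<subseteq> {0<..} \<Longrightarrow> S \<in> sets lebesgue \<Longrightarrow> \<phi> \<in> borel_measurable (lebesgue_on S)"
  using continuous_on_subset[OF C1_continuous[OF phi_C1]]
  by (intro continuous_imp_measurable_on_sets_lebesgue)

lemma M_weight_measurable:
  assumes "v \<in> borel_measurable (lebesgue_on S)" "S \<subseteq> {0<..}" "S \<in> sets lebesgue"
  shows "(\<lambda>x. M \<bar>v x\<bar> * exp (- \<phi> x)) \<in> borel_measurable (lebesgue_on S)"
proof -
  note [measurable] = assms(1) phi_measurable[OF assms(2,3)]
  show ?thesis by measurable
qed

lemma deriv_measurable: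
  assumes "u \<in> W11_loc" "S \<subseteq> {0<..}" "S \<in> sets lebesgue"
  shows "deriv u \<in> borel_measurable (lebesgue_on S)"
  by (rule measurable_restrict_mono[OF W11_loc_deriv_measurable[OF assms(1)] assms(2)])

text \<open>
  The dual norm in \<open>A\<^sub>\<phi>\<close> is tested with \<open>v = f\<^sub>\<phi> \<bar>u'\<bar> / t\<close> on \<open>[a, r]\<close>: the pairing with
  \<open>1 / f\<^sub>\<phi>\<close> is the integral of \<open>\<bar>u'\<bar> / t\<close>, and since \<open>c (f\<^sub>\<phi>) = e\<^sup>-\<^sup>\<phi>\<close> the modular of \<open>v\<close> is
  at most \<open>t\<^sup>-\<^sup>D\<close> times the weighted integral of \<open>M \<bar>u'\<bar>\<close>, hence at most \<open>1\<close>. The factor \<open>t\<close>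
  is kept because it is the source of the decay at the origin.
\<close>

lemma primitive_le_A_phi:
  assumes u: "u \<in> W11_loc" and a: "0 < a" "a < r"
    and A: "A_phi M d D \<phi> r < \<infinity>"
    and t: "0 < t" "t \<le> 1" and N: "mod_integral (deriv u) {0<..<r} \<le> ennreal (t powr D)"
  shows "\<bar>u r - u a\<bar> \<le> t * real_of_ereal (A_phi M d D \<phi> r)"
    and "0 \<le> real_of_ereal (A_phi M d D \<phi> r)"
proof -
  let ?S = "{0<..<r}" and ?f = "f_phi d D \<phi>"
  have S: "?S \<subseteq> {0<..}" "?S \<in> sets lebesgue" by auto
  define v where "v x = ?f x * (\<bar>deriv u x\<bar> / t) * indicator {a..r} x" for x
  note [measurable] = deriv_measurable[OF u S] phi_measurable[OF S]
  have [measurable]: "?f \<in> borel_measurable (lebesgue_on ?S)"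
    unfolding f_phi_eq[abs_def] by measurable
  have [measurable]: "indicator {a..r} \<in> borel_measurable (lebesgue_on ?S)"
    by (rule measurable_restrict_space1) (intro borel_measurable_indicator, simp)
  have vm [measurable]: "v \<in> borel_measurable (lebesgue_on ?S)"
    unfolding v_def [abs_def] by measurable
  have v0: "0 \<le> v x" for x using f_phi_pos[of \<phi> x] t by (simp add: v_def)
  have vM: "M \<bar>v x\<bar> \<le> (1 / t) powr D * (M \<bar>deriv u x\<bar> * exp (- \<phi> x))" for x
  proof -
    have "M \<bar>v x\<bar> \<le> M (?f x * (\<bar>deriv u x\<bar> / t))"
      using v0[of x] f_phi_pos[of \<phi> x] t by (intro M_mono) (auto simp: v_def split: split_indicator)
    also have "\<dots> \<le> exp (- \<phi> x) * M (\<bar>deriv u x\<bar> / t)"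
      using M_c_fun_bound[of "\<bar>deriv u x\<bar> / t" "?f x"] f_phi_pos[of \<phi> x] t by (simp add: c_fun_f_phi)
    also have "\<dots> \<le> exp (- \<phi> x) * ((1 / t) powr D * M \<bar>deriv u x\<bar>)"
      using M_power_bound_large[of "\<bar>deriv u x\<bar>" "1 / t"] t by (intro mult_left_mono) auto
    finally show ?thesis by (simp add: mult_ac)
  qed
  have "modular M ?S v \<le> (\<integral>\<^sup>+x. ennreal ((1 / t) powr D) * ennreal (M \<bar>deriv u x\<bar> * exp (- \<phi> x)) \<partial>lebesgue_on ?S)"
    unfolding modular_def using vM M_nonneg
    by (intro nn_integral_mono) (auto simp: ennreal_mult[symmetric])
  also have "\<dots> = ennreal ((1 / t) powr D) * mod_integral (deriv u) ?S"
    unfolding mod_integral_def using M_weight_measurable[OF deriv_measurable[OF u S] S]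
    by (intro nn_integral_cmult) auto
  also have "\<dots> \<le> ennreal ((1 / t) powr D) * ennreal (t powr D)"
    by (intro mult_left_mono N) auto
  also have "\<dots> = 1" using t by (simp add: ennreal_mult[symmetric] powr_mult[symmetric])
  finally have mod1: "modular M ?S v \<le> 1" .
  have adm: "v \<in> {v \<in> orlicz_space M ?S. modular M ?S v \<le> 1}"
    using vm mod1 by (auto simp: orlicz_space_def intro!: exI[of _ 1] le_less_trans[OF mod1])
  define I where "I = (\<integral>\<^sup>+x. ennreal \<bar>deriv u x\<bar> \<partial>lebesgue_on {a..r})"
  have pair: "1 / ?f x * v x = \<bar>deriv u x\<bar> / t * indicator {a..r} x" for x
    using f_phi_pos[of \<phi> x] by (simp add: v_def)
  have ext: "ext_integral ?S (\<lambda>x. 1 / ?f x * v x) = enn2ereal (ennreal (1 / t) * I)"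
  proof -
    have "(\<integral>\<^sup>+x. ennreal (1 / ?f x * v x) \<partial>lebesgue_on ?S)
        = (\<integral>\<^sup>+x. ennreal (1 / t) * (ennreal \<bar>deriv u x\<bar> * indicator {a..r} x) \<partial>lebesgue)"
      unfolding pair
    proof (subst nn_integral_restrict_space, force, rule nn_integral_cong_AE)
      have "AE x in lebesgue. x \<noteq> r" by (rule AE_completion) (rule AE_lborel_singleton)
      then show "AE x in lebesgue. ennreal (\<bar>deriv u x\<bar> / t * indicator {a..r} x) * indicator ?S x =
             ennreal (1 / t) * (ennreal \<bar>deriv u x\<bar> * indicator {a..r} x)"
        by eventually_elim (use a t in \<open>auto simp: ennreal_mult[symmetric] split: split_indicator\<close>)
    qed
    also have "\<dots> = ennreal (1 / t) * (\<integral>\<^sup>+x. ennreal \<bar>deriv u x\<bar> * indicator {a..r} x \<partial>lebesgue)"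
    proof (rule nn_integral_cmult)
      have "(\<lambda>x. ennreal \<bar>deriv u x\<bar>) \<in> borel_measurable (lebesgue_on {a..r})"
        using deriv_measurable[OF u, of "{a..r}"] a by (auto simp: subset_eq)
      then show "(\<lambda>x. ennreal \<bar>deriv u x\<bar> * indicator {a..r} x) \<in> borel_measurable lebesgue"
        by (subst (asm) borel_measurable_restrict_space_iff_ennreal) auto
    qed
    finally have 1: "(\<integral>\<^sup>+x. ennreal (1 / ?f x * v x) \<partial>lebesgue_on ?S) = ennreal (1 / t) * I"
      unfolding I_def by (simp add: nn_integral_restrict_space)
    have 2: "(\<integral>\<^sup>+x. ennreal (- (1 / ?f x * v x)) \<partial>lebesgue_on ?S) = 0"
      unfolding pair using t by (auto simp: ennreal_neg split: split_indicator)
    show ?thesis unfolding ext_integral_def 1 2 by (simp add: zero_ennreal.rep_eq)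
  qed
  have le: "enn2ereal (ennreal (1 / t) * I) \<le> A_phi M d D \<phi> r"
    unfolding A_phi_def dual_norm_def ext[symmetric] by (rule SUP_upper[OF adm])
  then have A0: "0 \<le> A_phi M d D \<phi> r" by (meson enn2ereal_nonneg order_trans)
  define \<alpha> where "\<alpha> = real_of_ereal (A_phi M d D \<phi> r)"
  have \<alpha>: "A_phi M d D \<phi> r = ereal \<alpha>" using A A0 by (cases "A_phi M d D \<phi> r") (auto simp: \<alpha>_def)
  show \<alpha>0: "0 \<le> real_of_ereal (A_phi M d D \<phi> r)"
    using A0 by (simp add: real_of_ereal_pos)
  have "ennreal (1 / t) * I \<le> e2ennreal (ereal \<alpha>)"
    using e2ennreal_mono[OF le] unfolding \<alpha> by simp
  then have "ennreal t * (ennreal (1 / t) * I) \<le> ennreal t * ennreal \<alpha>"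
    by (intro mult_left_mono) (auto simp: e2ennreal_ereal)
  then have "I \<le> ennreal (t * \<alpha>)"
    using t \<alpha>0 by (simp add: mult.assoc[symmetric] ennreal_mult[symmetric] \<alpha>_def)
  then have "ennreal \<bar>u r - u a\<bar> \<le> ennreal (t * \<alpha>)"
    using W11_loc_increment_le[OF u, of a r] a unfolding I_def by (auto intro: order_trans)
  then show "\<bar>u r - u a\<bar> \<le> t * real_of_ereal (A_phi M d D \<phi> r)"
    using t \<alpha>0 by (simp add: \<alpha>_def)
qed

lemma hardy_transform_le_A_phi:
  assumes u: "u \<in> hardy_transforms" and r: "0 < r"
    and A: "A_phi M d D \<phi> r < \<infinity>"
    and t: "0 < t" "t \<le> 1" and N: "mod_integral (deriv u) {0<..<r} \<le> ennreal (t powr D)"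
  shows "\<bar>u r\<bar> \<le> t * real_of_ereal (A_phi M d D \<phi> r)"
proof -
  have W: "u \<in> W11_loc" and lim: "(u \<longlongrightarrow> 0) (at_right 0)" using u by (auto simp: hardy_transforms_def)
  have "((\<lambda>a. \<bar>u r - u a\<bar>) \<longlongrightarrow> \<bar>u r - 0\<bar>) (at_right 0)"
    by (intro tendsto_intros lim)
  moreover have "\<forall>\<^sub>F a in at_right 0. \<bar>u r - u a\<bar> \<le> t * real_of_ereal (A_phi M d D \<phi> r)"
    using primitive_le_A_phi(1)[OF W _ _ A t N] r by (auto simp: eventually_at_right_field)
  ultimately show ?thesis
    by (intro tendsto_upperbound[of "\<lambda>a. \<bar>u r - u a\<bar>"]) auto
qed

text \<open>
  Boundedness of \<open>K\<close> alone would give a bounded energy. The energy is small because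
  the weighted integral of \<open>M \<bar>u'\<bar>\<close> over \<open>(0, r)\<close> tends to \<open>0\<close>, so that \<open>u\<close> is small
  compared with \<open>A\<^sub>\<phi>\<close>.
\<close>

lemma energy_vanishes_at_0:
  assumes u: "u \<in> hardy_transforms" and fin: "mod_integral (deriv u) {0<..} < \<infinity>"
    and e: "0 < e"
  shows "\<forall>\<^sub>F r in at_right 0. energy u r \<le> e"
proof -
  have W: "u \<in> W11_loc" using u by (auto simp: hardy_transforms_def)
  obtain K where K: "0 < K" "\<forall>\<^sub>F r in at_right 0. norm (K_fun M d D \<phi> \<omega> r) \<le> K"
    using K_bounded by (auto simp: Bfun_def)
  \<comment> \<open>the energy will turn out to be at most \<open>t K\<close>\<close>
  define t where "t = min 1 (e / K)"
  have t: "0 < t" "t \<le> 1" "t * K \<le> e" using e K by (auto simp: t_def min_def field_simps)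
  obtain r0 where r0: "0 < r0" "mod_integral (deriv u) {0<..<r0} < ennreal (t powr D)"
  proof (rule nn_integral_on_vanish_at_0)
    have "(\<lambda>x. M \<bar>deriv u x\<bar> * exp (- \<phi> x)) \<in> borel_measurable (lebesgue_on {0<..})"
      by (rule M_weight_measurable[OF deriv_measurable[OF W subset_refl] subset_refl]) auto
    then show "(\<lambda>x. ennreal (M \<bar>deriv u x\<bar> * exp (- \<phi> x))) \<in> borel_measurable (lebesgue_on {0<..})"
      by simp
    show "0 < ennreal (t powr D)" using t by simp
  qed (use fin in \<open>auto simp: mod_integral_def\<close>)
  have "\<forall>\<^sub>F r in at_right 0. r \<in> {0<..<r0}" using r0(1) by (rule eventually_at_right_real)
  then show ?thesis using K(2) A_finite
  proof eventually_elim
    case (elim r)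
    then have r: "0 < r" "r < r0" by auto
    have N: "mod_integral (deriv u) {0<..<r} \<le> ennreal (t powr D)"
    proof -
      have "mod_integral (deriv u) {0<..<r} \<le> mod_integral (deriv u) {0<..<r0}"
        unfolding mod_integral_def using r by (intro nn_integral_on_mono) auto
      then show ?thesis using r0(2) by auto
    qed
    define \<alpha> where "\<alpha> = real_of_ereal (A_phi M d D \<phi> r)"
    have \<alpha>: "0 \<le> \<alpha>"
      using primitive_le_A_phi(2)[OF W _ _ elim(3) t(1,2) N, of "r / 2"] r by (simp add: \<alpha>_def)
    have ur: "\<bar>u r\<bar> \<le> t * \<alpha>"
      using hardy_transform_le_A_phi[OF u r(1) elim(3) t(1,2) N] by (simp add: \<alpha>_def)
    have "\<bar>\<omega> r * u r\<bar> \<le> t * (\<omega> r * \<alpha>)"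
      using mult_left_mono[OF ur omega_nonneg[OF r(1)]] omega_nonneg[OF r(1)] by (simp add: abs_mult mult_ac)
    then have "M \<bar>\<omega> r * u r\<bar> \<le> M (t * (\<omega> r * \<alpha>))" by (intro M_mono) auto
    also have "\<dots> \<le> t * M (\<omega> r * \<alpha>)"
      using t \<alpha> omega_nonneg[OF r(1)] by (intro M_scale_le) auto
    finally have "energy u r \<le> t * M (\<omega> r * \<alpha>) * weight r"
      unfolding energy_def using weight_pos[OF r(1)] by (intro mult_right_mono) auto
    also have "\<dots> = t * K_fun M d D \<phi> \<omega> r"
      by (simp add: K_fun_def weight_eq[OF r(1)] \<alpha>_def)
    also have "\<dots> \<le> t * K" using elim(2) t by (intro mult_left_mono) auto
    also have "\<dots> \<le> e" by (rule t(3))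
    finally show ?case .
  qed
qed

text \<open>
  The integral of the gain is added to the energy as a continuously differentiable function \<open>P\<close>,
  so that a one-sided bound on a single derivative has to be integrated.
\<close>

lemma energy_inequality:
  assumes u: "u \<in> W11_loc" and a: "0 < a" "a \<le> c"
  shows "ennreal (b / 2) * mod_integral (\<lambda>x. \<omega> x * u x) {a..c}
     \<le> ennreal (energy u a) + ennreal energy_const * mod_integral (deriv u) {0<..}"
proof -
  let ?g = "\<lambda>x. M \<bar>\<omega> x * u x\<bar> * exp (- \<phi> x)"
  have ac: "{a..c} \<subseteq> {0<..}" using a by auto
  have g_cont: "continuous_on {0<..} ?g"
    by (intro continuous_intros continuous_on_compose2[OF M_abs_continuous]
        C1_continuous[OF omega_C1] C1_continuous[OF phi_C1] W11_loc_continuous[OF u]) auto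
  have gc: "continuous_on {a..c} ?g" by (rule continuous_on_subset[OF g_cont ac])
  have gc2: "continuous_on {a..c} (\<lambda>x. b / 2 * ?g x)" by (rule continuous_on_mult_left[OF gc])
  have g0: "0 \<le> ?g x" for x using M_nonneg by simp
  define P where "P x = integral {a..x} (\<lambda>y. b / 2 * ?g y)" for x
  have Pder: "(P has_real_derivative b / 2 * ?g x) (at x)" if "x \<in> {a<..<c}" for x
  proof -
    have "(P has_real_derivative b / 2 * ?g x) (at x within {a..c})"
      unfolding P_def [abs_def] by (rule integral_has_real_derivative[OF gc2]) (use that in auto)
    then show ?thesis using that by (simp add: at_within_Icc_at)
  qed
  have Pac: "abs_continuous_on a c P"
  proof -
    have Pd: "(P has_real_derivative b / 2 * ?g x) (at x within {a..c})" if "x \<in> {a..c}" for x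
      unfolding P_def [abs_def] by (rule integral_has_real_derivative[OF gc2]) (use that in auto)
    have "bounded ((\<lambda>x. b / 2 * ?g x) ` {a..c})"
      using gc2 by (intro compact_imp_bounded compact_continuous_image) auto
    then obtain B where B: "\<forall>x\<in>{a..c}. \<bar>b / 2 * ?g x\<bar> \<le> B" by (auto simp: bounded_iff)
    show ?thesis
    proof (rule abs_continuous_on_Lipschitz)
      fix s t assume st: "a \<le> s" "s \<le> t" "t \<le> c"
      have "norm (P t - P s) \<le> B * norm (t - s)"
        by (rule field_differentiable_bound[where S="{a..c}"]) (use Pd B st in auto)
      then show "\<bar>P t - P s\<bar> \<le> B * (t - s)" using st by simp
    qed
  qed
  have Pa: "P a = 0" by (simp add: P_def)
  have ae: "AE x in lebesgue_on {a..c}. (u has_real_derivative deriv u x) (at x) \<and> x \<noteq> a \<and> x \<noteq> c"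
  proof -
    have "AE x in lebesgue. x \<noteq> a" "AE x in lebesgue. x \<noteq> c"
      by (rule AE_completion, rule AE_lborel_singleton)+
    then have "AE x in lebesgue_on {a..c}. x \<noteq> a" "AE x in lebesgue_on {a..c}. x \<noteq> c"
      by (auto simp: AE_restrict_space_iff elim: eventually_mono)
    with W11_loc_deriv[OF u a(1), of c] show ?thesis by eventually_elim auto
  qed
  have Mm: "(\<lambda>x. M \<bar>deriv u x\<bar> * exp (- \<phi> x)) \<in> borel_measurable (lebesgue_on {a..c})"
    by (rule M_weight_measurable[OF deriv_measurable[OF u ac] ac]) auto
  have "ennreal ((energy u c + P c) - (energy u a + P a))
      \<le> (\<integral>\<^sup>+x. ennreal (energy_const * (M \<bar>deriv u x\<bar> * exp (- \<phi> x))) \<partial>lebesgue_on {a..c})"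
  proof (rule abs_continuous_increment_le)
    show "abs_continuous_on a c (\<lambda>x. energy u x + P x)"
      by (rule abs_continuous_on_add[OF energy_abs_continuous[OF u a(1)] Pac])
    show "AE x in lebesgue_on {a..c}. \<exists>l. ((\<lambda>x. energy u x + P x) has_real_derivative l) (at x)
        \<and> l \<le> energy_const * (M \<bar>deriv u x\<bar> * exp (- \<phi> x))"
      using ae AE_space
    proof eventually_elim
      case (elim x)
      then have x: "x \<in> {a<..<c}" by (auto simp: space_restrict_space)
      with a have "0 < x" by auto
      from energy_deriv[OF this] elim(1) obtain l where l: "(energy u has_real_derivative l) (at x)"
        "l \<le> energy_const * (M \<bar>deriv u x\<bar> * exp (- \<phi> x)) - b / 2 * ?g x" by blast
      show ?case using l by (intro exI[of _ "l + b / 2 * ?g x"] conjI DERIV_add Pder[OF x]) auto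
    qed
  qed (use Mm energy_const_pos M_nonneg a in auto)
  also have "\<dots> = (\<integral>\<^sup>+x. ennreal energy_const * ennreal (M \<bar>deriv u x\<bar> * exp (- \<phi> x)) \<partial>lebesgue_on {a..c})"
    using energy_const_pos M_nonneg by (simp add: ennreal_mult)
  also have "\<dots> = ennreal energy_const * mod_integral (deriv u) {a..c}"
    unfolding mod_integral_def by (rule nn_integral_cmult) (use Mm in simp)
  also have "\<dots> \<le> ennreal energy_const * mod_integral (deriv u) {0<..}"
    unfolding mod_integral_def by (intro mult_left_mono nn_integral_on_mono ac) auto
  finally have 1: "ennreal (energy u c + P c - energy u a) \<le> ennreal energy_const * mod_integral (deriv u) {0<..}"
    by (simp add: Pa algebra_simps)
  have en0: "0 \<le> energy u x" if "0 < x" for x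
    using weight_pos[OF that] M_nonneg by (simp add: energy_def)
  have "ennreal (P c) \<le> ennreal (energy u a + (energy u c + P c - energy u a))"
    using en0[of c] a by (intro ennreal_leI) auto
  also have "\<dots> \<le> ennreal (energy u a) + ennreal (energy u c + P c - energy u a)"
    using en0[of a] a by (cases "0 \<le> energy u c + P c - energy u a")
      (auto simp: ennreal_neg ennreal_plus[symmetric] simp del: ennreal_plus intro!: ennreal_leI)
  also have "\<dots> \<le> ennreal (energy u a) + ennreal energy_const * mod_integral (deriv u) {0<..}"
    by (intro add_left_mono 1)
  finally have 2: "ennreal (P c) \<le> ennreal (energy u a) + ennreal energy_const * mod_integral (deriv u) {0<..}" .
  have gi: "integrable (lebesgue_on {a..c}) ?g"
    by (rule continuous_imp_integrable_real[OF gc])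
  have "ennreal (b / 2) * mod_integral (\<lambda>x. \<omega> x * u x) {a..c} = ennreal (b / 2) * ennreal (integral {a..c} ?g)"
    unfolding mod_integral_def
    using nn_integral_eq_integral[OF gi AE_I2[OF g0]] lebesgue_integral_eq_integral[OF gi] by simp
  also have "\<dots> = ennreal (b / 2 * integral {a..c} ?g)"
  proof (rule ennreal_mult[symmetric])
    show "0 \<le> integral {a..c} ?g"
      using g0 by (intro integral_nonneg integrable_continuous_real[OF gc])
  qed (use b_pos in auto)
  also have "\<dots> = ennreal (P c)"
    unfolding P_def by (subst integral_mult_right) (rule refl)
  finally show ?thesis using 2 by simp
qed

text \<open>
  The energy inequality on \<open>[a, n]\<close>, in the limits \<open>a \<rightarrow> 0\<close>, where the energy vanishes, and
  \<open>n \<rightarrow> \<infinity>\<close>.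
\<close>

lemma hardy_inequality:
  assumes u: "u \<in> hardy_transforms"
  shows "mod_integral (\<lambda>x. \<omega> x * u x) {0<..} \<le> ennreal (2 * energy_const / b) * mod_integral (deriv u) {0<..}"
proof (cases "mod_integral (deriv u) {0<..} < \<infinity>")
  case False
  then have "mod_integral (deriv u) {0<..} = \<infinity>" by (simp add: not_less top_unique)
  then show ?thesis using energy_const_pos b_pos by (simp add: ennreal_mult_top)
next
  case True
  have W: "u \<in> W11_loc" using u by (auto simp: hardy_transforms_def)
  let ?N = "mod_integral (deriv u) {0<..}"
  let ?A = "\<lambda>n::nat. {1 / real (Suc n)..real (Suc n)}"
  have bound: "ennreal (b / 2) * mod_integral (\<lambda>x. \<omega> x * u x) (?A n) \<le> ennreal energy_const * ?N" for n
  proof (rule ennreal_le_epsilon)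
    fix e :: real assume "0 < e"
    have "\<forall>\<^sub>F r in at_right 0. r \<in> {0<..<1 / real (Suc n)}" by (rule eventually_at_right_real) simp
    then have "\<forall>\<^sub>F r in at_right 0. r \<in> {0<..<1 / real (Suc n)} \<and> energy u r \<le> e"
      using energy_vanishes_at_0[OF u True \<open>0 < e\<close>] by eventually_elim auto
    from eventually_happens'[OF trivial_limit_at_right_real this]
    obtain a where a: "0 < a" "a < 1 / real (Suc n)" "energy u a \<le> e"
      by auto
    have "1 / real (Suc n) \<le> real (Suc n)" by (simp add: field_simps)
    then have ac: "a \<le> real (Suc n)" using a by linarith
    have "mod_integral (\<lambda>x. \<omega> x * u x) (?A n) \<le> mod_integral (\<lambda>x. \<omega> x * u x) {a..real (Suc n)}"
      unfolding mod_integral_def using a by (intro nn_integral_on_mono) auto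
    then have "ennreal (b / 2) * mod_integral (\<lambda>x. \<omega> x * u x) (?A n)
        \<le> ennreal (b / 2) * mod_integral (\<lambda>x. \<omega> x * u x) {a..real (Suc n)}"
      by (rule mult_left_mono) auto
    also have "\<dots> \<le> ennreal (energy u a) + ennreal energy_const * ?N"
      by (rule energy_inequality[OF W a(1) ac])
    also have "\<dots> \<le> ennreal e + ennreal energy_const * ?N"
      by (intro add_right_mono ennreal_leI a(3))
    finally show "ennreal (b / 2) * mod_integral (\<lambda>x. \<omega> x * u x) (?A n) \<le> ennreal energy_const * ?N + ennreal e"
      by (simp add: add.commute)
  qed
  have bound': "mod_integral (\<lambda>x. \<omega> x * u x) (?A n) \<le> ennreal (2 * energy_const / b) * ?N" for n
  proof -
    have "ennreal (2 / b) * (ennreal (b / 2) * mod_integral (\<lambda>x. \<omega> x * u x) (?A n)) \<le> ennreal (2 / b) * (ennreal energy_const * ?N)"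
      by (intro mult_left_mono bound) auto
    then show ?thesis using b_pos energy_const_pos by (simp add: mult.assoc[symmetric] ennreal_mult[symmetric])
  qed
  have U: "(\<Union>n. ?A n) = {0<..}"
    by (rule Union_Icc_exhausts_Ioi)
  have "(\<integral>\<^sup>+x. ennreal (M \<bar>\<omega> x * u x\<bar> * exp (- \<phi> x)) \<partial>lebesgue_on (\<Union>n. ?A n)) \<le> ennreal (2 * energy_const / b) * ?N"
  proof (rule nn_integral_on_exhaust)
    show "incseq ?A" by (intro incseq_SucI) (auto simp: field_simps)
    fix n
    have sub: "?A n \<subseteq> {0<..}" by (auto intro: less_le_trans[rotated])
    have "(\<lambda>x. \<omega> x * u x) \<in> borel_measurable (lebesgue_on (?A n))"
      by (intro continuous_imp_measurable_on_sets_lebesgue continuous_on_subset[OF _ sub] continuous_intros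
        C1_continuous[OF omega_C1] W11_loc_continuous[OF W]) auto
    from M_weight_measurable[OF this sub] show "(\<lambda>x. ennreal (M \<bar>\<omega> x * u x\<bar> * exp (- \<phi> x))) \<in> borel_measurable (lebesgue_on (?A n))"
      by auto
  qed (use bound' in \<open>auto simp: mod_integral_def\<close>)
  then show ?thesis unfolding U mod_integral_def .
qed

section \<open>The dual weight condition\<close>

definition hardy_const where "hardy_const = 2 * energy_const / b"

lemma hardy_const_pos: "0 < hardy_const" using energy_const_pos b_pos by (simp add: hardy_const_def)

text \<open>
  The Hardy inequality for the primitive of \<open>g\<close>, which is constant to the right of \<open>c\<close>.
\<close>

lemma tail_estimate:
  assumes a: "0 < a" "a < c" and mono: "mono_on {a..c} g \<or> mono_on {a..c} (\<lambda>x. - g x)"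
    and g0: "\<And>x. x \<in> {a..c} \<Longrightarrow> 0 \<le> g x"
  shows "(\<integral>\<^sup>+x. ennreal (M (integral {a..c} g * \<omega> x) * exp (- \<phi> x)) \<partial>lebesgue_on {c<..})
     \<le> ennreal hardy_const * (\<integral>\<^sup>+x. ennreal (M (g x) * exp (- \<phi> x)) \<partial>lebesgue_on {a..c})"
proof -
  obtain u where u: "u \<in> hardy_transforms"
    and du: "AE x in lebesgue_on {0<..}. deriv u x = (if x \<in> {a..c} then g x else 0)"
    and uc: "\<And>x. c \<le> x \<Longrightarrow> u x = integral {a..c} g"
    by (rule primitive_of_monotone[OF a mono]) (erule g0, rule that, assumption+)
  have V: "0 \<le> integral {a..c} g"
    by (rule integral_nonneg[OF monotone_integrable_on[OF mono] g0])
  have "(\<integral>\<^sup>+x. ennreal (M (integral {a..c} g * \<omega> x) * exp (- \<phi> x)) \<partial>lebesgue_on {c<..})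
      = mod_integral (\<lambda>x. \<omega> x * u x) {c<..}"
    unfolding mod_integral_def using uc V a omega_nonneg
    by (intro nn_integral_cong) (auto simp: space_restrict_space abs_mult mult.commute)
  also have "\<dots> \<le> mod_integral (\<lambda>x. \<omega> x * u x) {0<..}"
    unfolding mod_integral_def using a by (intro nn_integral_on_mono) auto
  also have "\<dots> \<le> ennreal hardy_const * mod_integral (deriv u) {0<..}"
    unfolding hardy_const_def by (rule hardy_inequality[OF u])
  also have "mod_integral (deriv u) {0<..}
      = (\<integral>\<^sup>+x. ennreal (M (g x) * exp (- \<phi> x)) * indicator {a..c} x \<partial>lebesgue_on {0<..})"
    unfolding mod_integral_def
  proof (rule nn_integral_cong_AE)
    show "AE x in lebesgue_on {0<..}. ennreal (M \<bar>deriv u x\<bar> * exp (- \<phi> x))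
        = ennreal (M (g x) * exp (- \<phi> x)) * indicator {a..c} x"
      using du by eventually_elim (use g0 in auto)
  qed
  also have "\<dots> = (\<integral>\<^sup>+x. ennreal (M (g x) * exp (- \<phi> x)) \<partial>lebesgue_on {a..c})"
    using a by (auto simp: nn_integral_restrict_space intro!: nn_integral_cong split: split_indicator)
  finally show ?thesis .
qed

text \<open>
  The tail estimate applied to the constant \<open>2 \<epsilon> / y\<close> on \<open>[y/2, y]\<close>, whose
  integral is \<open>\<epsilon>\<close>.
\<close>

lemma G_fun_finite:
  assumes y: "0 < y" and e: "0 < \<epsilon>"
  shows "G_fun M \<phi> \<omega> \<epsilon> y < \<infinity>"
proof -
  let ?g = "\<lambda>x::real. 2 * \<epsilon> / y"
  have "integral {y / 2..y} ?g = \<epsilon>" using y by simp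
  then have le: "G_fun M \<phi> \<omega> \<epsilon> y \<le> ennreal hardy_const * (\<integral>\<^sup>+x. ennreal (M (2 * \<epsilon> / y) * exp (- \<phi> x)) \<partial>lebesgue_on {y / 2..y})"
    using tail_estimate[of "y / 2" y ?g] y e by (simp add: G_fun_def mono_on_def)
  have "(\<integral>\<^sup>+x. ennreal (M (2 * \<epsilon> / y) * exp (- \<phi> x)) \<partial>lebesgue_on {y / 2..y}) < \<infinity>"
  proof -
    have "continuous_on {y / 2..y} (\<lambda>x. M (2 * \<epsilon> / y) * exp (- \<phi> x))"
      by (intro continuous_intros continuous_on_subset[OF C1_continuous[OF phi_C1]]) (use y in auto)
    then have i: "integrable (lebesgue_on {y / 2..y}) (\<lambda>x. M (2 * \<epsilon> / y) * exp (- \<phi> x))"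
      by (rule continuous_imp_integrable_real)
    show ?thesis using y e by (subst nn_integral_eq_integral[OF i]) (auto intro!: AE_I2 mult_nonneg_nonneg M_nonneg)
  qed
  then show ?thesis by (intro le_less_trans[OF le]) (simp add: ennreal_mult_less_top)
qed

lemma phi_monotone:
  assumes "0 < x" "x \<le> y"
  shows "\<sigma> * \<phi> x \<le> \<sigma> * \<phi> y"
proof (rule DERIV_nonneg_imp_nondecreasing[OF assms(2)])
  fix z assume "x \<le> z" "z \<le> y"
  with assms have "0 < z" by simp
  then show "\<exists>l. ((\<lambda>x. \<sigma> * \<phi> x) has_real_derivative l) (at z) \<and> 0 \<le> l"
    using dphi_sign[of z] by (intro exI[of _ "\<sigma> * deriv \<phi> z"] conjI DERIV_cmult C1_has_deriv[OF phi_C1]) auto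
qed

text \<open>
  The test function \<open>g\<close> is a maximiser in the definition of \<open>M\<^sup>* (k e\<^sup>\<phi>)\<close> and \<open>\<Psi>\<close> is the resulting
  value of \<open>M\<^sup>* (k e\<^sup>\<phi>) e\<^sup>-\<^sup>\<phi>\<close>. Working with \<open>\<Psi>\<close> instead of \<open>M\<^sup>*\<close> gives measurability directly. The
  interval is cut off at \<open>a > 0\<close> to keep \<open>g\<close> bounded, and \<open>a\<close> tends to \<open>0\<close> at the end.
\<close>

lemma dual_estimate:
  assumes y: "0 < y" and e: "0 < \<epsilon>" and B: "B = 1 + hardy_const"
  shows "(\<integral>\<^sup>+x. ennreal (complementary M
                      (enn2real (G_fun M \<phi> \<omega> \<epsilon> y) / (B * \<epsilon> * exp (- \<phi> x))) * exp (- \<phi> x))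
                \<partial>lebesgue_on {0<..<y})
            \<le> G_fun M \<phi> \<omega> \<epsilon> y"
proof -
  define G where "G = enn2real (G_fun M \<phi> \<omega> \<epsilon> y)"
  have G0: "0 \<le> G" by (simp add: G_def)
  have G_eq: "G_fun M \<phi> \<omega> \<epsilon> y = ennreal G"
    using G_fun_finite[OF y e] by (simp add: G_def)
  have B1: "1 \<le> B" "hardy_const < B" using hardy_const_pos B by auto
  define k where "k = G / (B * \<epsilon>)"
  have k0: "0 \<le> k" using G0 B1 e by (simp add: k_def)
  define g where "g x = legendre_argmax (k * exp (\<phi> x))" for x
  have g0: "0 \<le> g x" for x unfolding g_def by (rule legendre_argmax_nonneg) (simp add: k0)
  define \<Psi> where "\<Psi> x = k * g x - M (g x) * exp (- \<phi> x)" for x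
  have compl: "complementary M (G / (B * \<epsilon> * exp (- \<phi> x))) * exp (- \<phi> x) \<le> \<Psi> x" for x
  proof -
    have t: "G / (B * \<epsilon> * exp (- \<phi> x)) = k * exp (\<phi> x)" by (simp add: k_def exp_minus field_simps)
    have "complementary M (k * exp (\<phi> x)) * exp (- \<phi> x) \<le> (k * exp (\<phi> x) * g x - M (g x)) * exp (- \<phi> x)"
      unfolding g_def using k0 by (intro mult_right_mono complementary_le_argmax) auto
    also have "\<dots> = \<Psi> x" by (simp add: \<Psi>_def exp_minus field_simps)
    finally show ?thesis unfolding t .
  qed
  have \<Psi>0: "0 \<le> \<Psi> x" for x
  proof -
    have "0 \<le> k * exp (\<phi> x) * g x - M (g x)"
      using legendre_argmax_max[of "k * exp (\<phi> x)" 0] k0 by (simp add: g_def)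
    then have "0 \<le> (k * exp (\<phi> x) * g x - M (g x)) * exp (- \<phi> x)" by simp
    also have "\<dots> = \<Psi> x" by (simp add: \<Psi>_def exp_minus field_simps)
    finally show ?thesis .
  qed
  have mono: "mono_on {a..y} g \<or> mono_on {a..y} (\<lambda>x. - g x)" if a: "0 < a" for a
  proof -
    have "\<sigma> = 1 \<or> \<sigma> = - 1" using sigma by auto
    then show ?thesis
    proof
      assume "\<sigma> = 1"
      then have "mono_on {a..y} g" unfolding g_def
        using phi_monotone a k0 by (intro mono_onI legendre_argmax_mono mult_left_mono) auto
      then show ?thesis ..
    next
      assume "\<sigma> = - 1"
      then have "mono_on {a..y} (\<lambda>x. - g x)" unfolding g_def
        using phi_monotone a k0 by (intro mono_onI le_imp_neg_le legendre_argmax_mono mult_left_mono) force+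
      then show ?thesis ..
    qed
  qed
  have g_meas: "g \<in> borel_measurable (lebesgue_on {a..y})" if a: "0 < a" for a
  proof -
    have "g \<in> borel_measurable (restrict_space borel {a..y})"
    proof (cases "mono_on {a..y} g")
      case True
      then show ?thesis by (rule borel_measurable_mono_on_fnc)
    next
      case False
      then have "(\<lambda>x. - (- g x)) \<in> borel_measurable (restrict_space borel {a..y})"
        using mono[OF a] by (intro borel_measurable_uminus borel_measurable_mono_on_fnc) auto
      then show ?thesis by simp
    qed
    then show ?thesis
      by (auto simp: measurable_def sets_restrict_space space_restrict_space)
  qed
  have \<Psi>_meas: "\<Psi> \<in> borel_measurable (lebesgue_on {a..y})" if a: "0 < a" for a
  proof -
    have "(\<lambda>x. M \<bar>g x\<bar> * exp (- \<phi> x)) \<in> borel_measurable (lebesgue_on {a..y})"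
      by (rule M_weight_measurable[OF g_meas[OF a]]) (use a in auto)
    then have "(\<lambda>x. M (g x) * exp (- \<phi> x)) \<in> borel_measurable (lebesgue_on {a..y})"
      by (simp add: g0)
    then show ?thesis unfolding \<Psi>_def [abs_def] using g_meas[OF a] by simp
  qed
  have bound: "(\<integral>\<^sup>+x. ennreal (\<Psi> x) \<partial>lebesgue_on {a..y}) \<le> ennreal G" if a: "0 < a" "a < y" for a
  proof -
    define V where "V = integral {a..y} g"
    have V0: "0 \<le> V"
      unfolding V_def by (rule integral_nonneg[OF monotone_integrable_on[OF mono[OF a(1)]] g0])
    have V_eq: "ennreal V = (\<integral>\<^sup>+x. ennreal (g x) \<partial>lebesgue_on {a..y})"
      unfolding V_def by (rule integral_monotone_eq_nn_integral[OF mono[OF a(1)] g0])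
    define J where "J = (\<integral>\<^sup>+x. ennreal (M (g x) * exp (- \<phi> x)) \<partial>lebesgue_on {a..y})"
    define I where "I = (\<integral>\<^sup>+x. ennreal (\<Psi> x) \<partial>lebesgue_on {a..y})"
    have "(\<integral>\<^sup>+x. ennreal (M (g x) * exp (- \<phi> x)) + ennreal (\<Psi> x) \<partial>lebesgue_on {a..y})
        = (\<integral>\<^sup>+x. ennreal k * ennreal (g x) \<partial>lebesgue_on {a..y})"
      using g0 M_nonneg \<Psi>0 k0
      by (intro nn_integral_cong) (simp add: \<Psi>_def ennreal_plus[symmetric] ennreal_mult[symmetric] del: ennreal_plus)
    also have "\<dots> = ennreal k * ennreal V"
      unfolding V_eq by (rule nn_integral_cmult) (use g_meas[OF a(1)] in simp)
    also have "\<dots> = ennreal (k * V)" using k0 V0 by (simp add: ennreal_mult)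
    finally have sum: "(\<integral>\<^sup>+x. ennreal (M (g x) * exp (- \<phi> x)) + ennreal (\<Psi> x) \<partial>lebesgue_on {a..y}) = ennreal (k * V)" .
    have J_le: "J \<le> ennreal (k * V)" and I_le: "I \<le> ennreal (k * V)"
      unfolding sum[symmetric] I_def J_def
      by (intro nn_integral_mono add_increasing2 zero_le order_refl)
        (intro nn_integral_mono add_increasing zero_le order_refl)
    \<comment> \<open>if \<open>V\<close> exceeded \<open>B \<epsilon>\<close>, the tail estimate would contradict \<open>B > C\<close>\<close>
    have "k * V \<le> G"
    proof (rule ccontr)
      assume neg: "\<not> k * V \<le> G"
      then have Gpos: "0 < G" using G0 V0 by (cases "G = 0") (auto simp: k_def)
      have VB: "B * \<epsilon> < V"
      proof (rule ccontr)
        assume "\<not> B * \<epsilon> < V"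
        then have "k * V \<le> k * (B * \<epsilon>)" using k0 by (intro mult_left_mono) auto
        also have "\<dots> = G" using B1 e by (simp add: k_def)
        finally show False using neg by simp
      qed
      have "\<epsilon> \<le> B * \<epsilon>" using mult_right_mono[OF B1(1), of \<epsilon>] e by simp
      with VB have "\<epsilon> \<le> V" by linarith
      then have V\<epsilon>: "1 \<le> V / \<epsilon>" using e by simp
      have "ennreal (V / \<epsilon>) * ennreal G = ennreal (V / \<epsilon>) * (\<integral>\<^sup>+x. ennreal (M (\<epsilon> * \<omega> x) * exp (- \<phi> x)) \<partial>lebesgue_on {y<..})"
        unfolding G_eq[symmetric] G_fun_def ..
      also have "\<dots> = (\<integral>\<^sup>+x. ennreal (V / \<epsilon>) * ennreal (M (\<epsilon> * \<omega> x) * exp (- \<phi> x)) \<partial>lebesgue_on {y<..})"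
      proof (rule nn_integral_cmult[symmetric])
        have "(\<lambda>x. \<epsilon> * \<omega> x) \<in> borel_measurable (lebesgue_on {y<..})"
          by (intro continuous_imp_measurable_on_sets_lebesgue continuous_intros
             continuous_on_subset[OF C1_continuous[OF omega_C1]]) (use y in auto)
        from M_weight_measurable[OF this] have "(\<lambda>x. M \<bar>\<epsilon> * \<omega> x\<bar> * exp (- \<phi> x)) \<in> borel_measurable (lebesgue_on {y<..})"
          using y by auto
        then have "(\<lambda>x. M (\<epsilon> * \<omega> x) * exp (- \<phi> x)) \<in> borel_measurable (lebesgue_on {y<..})"
          by (rule measurable_cong[THEN iffD1, rotated])
            (use y e omega_nonneg in \<open>auto simp: space_restrict_space abs_mult\<close>)
        then show "(\<lambda>x. ennreal (M (\<epsilon> * \<omega> x) * exp (- \<phi> x))) \<in> borel_measurable (lebesgue_on {y<..})"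
          by simp
      qed
      also have "\<dots> \<le> (\<integral>\<^sup>+x. ennreal (M (V * \<omega> x) * exp (- \<phi> x)) \<partial>lebesgue_on {y<..})"
      proof (rule nn_integral_mono)
        fix x assume "x \<in> space (lebesgue_on {y<..})"
        then have x: "0 < x" using y by (simp add: space_restrict_space)
        have "V / \<epsilon> * M (\<epsilon> * \<omega> x) \<le> M (V / \<epsilon> * (\<epsilon> * \<omega> x))"
          using V\<epsilon> e omega_nonneg[OF x] by (intro M_scale_ge) auto
        also have "V / \<epsilon> * (\<epsilon> * \<omega> x) = V * \<omega> x" using e by simp
        finally have "V / \<epsilon> * M (\<epsilon> * \<omega> x) * exp (- \<phi> x) \<le> M (V * \<omega> x) * exp (- \<phi> x)"
          by (intro mult_right_mono) auto
        then show "ennreal (V / \<epsilon>) * ennreal (M (\<epsilon> * \<omega> x) * exp (- \<phi> x)) \<le> ennreal (M (V * \<omega> x) * exp (- \<phi> x))"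
          using V0 e M_nonneg[of "\<epsilon> * \<omega> x"] omega_nonneg[OF x]
          by (simp add: ennreal_mult[symmetric] mult.assoc ennreal_leI)
      qed
      also have "\<dots> \<le> ennreal hardy_const * J"
        unfolding V_def J_def by (rule tail_estimate[OF a mono[OF a(1)] g0])
      also have "\<dots> \<le> ennreal hardy_const * ennreal (k * V)" by (intro mult_left_mono J_le) auto
      finally have "ennreal (V / \<epsilon> * G) \<le> ennreal (hardy_const * (k * V))"
        using V0 e G0 hardy_const_pos k0 by (simp add: ennreal_mult[symmetric])
      then have "V / \<epsilon> * G \<le> hardy_const * (k * V)" using hardy_const_pos k0 V0 by (simp add: ennreal_le_iff)
      also have "\<dots> = (hardy_const / B) * (V / \<epsilon> * G)" by (simp add: k_def)
      finally have "1 * (V / \<epsilon> * G) \<le> (hardy_const / B) * (V / \<epsilon> * G)" by simp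
      moreover have "0 < V / \<epsilon> * G" using V\<epsilon> Gpos by (intro mult_pos_pos) auto
      ultimately have "1 \<le> hardy_const / B" by (simp only: mult_le_cancel_right_pos)
      then show False using B1 by simp
    qed
    then show ?thesis using I_le unfolding I_def by (meson ennreal_leI order_trans)
  qed
  let ?A = "\<lambda>n::nat. {y / real (Suc (Suc n))..y}"
  have U: "{0<..<y} \<subseteq> (\<Union>n. ?A n)"
  proof
    fix x assume x: "x \<in> {0<..<y}"
    then have "0 < x / y" by simp
    then obtain n where n: "1 / real (Suc n) < x / y" by (metis nat_approx_posE)
    have "1 / real (Suc (Suc n)) \<le> 1 / real (Suc n)" by (intro divide_left_mono) auto
    with n have "1 / real (Suc (Suc n)) * y < x / y * y" using y by (intro mult_strict_right_mono) auto
    then have "y / real (Suc (Suc n)) \<le> x" using y by simp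
    then show "x \<in> (\<Union>n. ?A n)" using x by (intro UN_I[of n]) auto
  qed
  have "(\<integral>\<^sup>+x. ennreal (complementary M (G / (B * \<epsilon> * exp (- \<phi> x))) * exp (- \<phi> x)) \<partial>lebesgue_on {0<..<y})
      \<le> (\<integral>\<^sup>+x. ennreal (\<Psi> x) \<partial>lebesgue_on {0<..<y})"
    by (intro nn_integral_mono ennreal_leI compl)
  also have "\<dots> \<le> (\<integral>\<^sup>+x. ennreal (\<Psi> x) \<partial>lebesgue_on (\<Union>n. ?A n))"
    by (intro nn_integral_on_mono U) auto
  also have "\<dots> \<le> ennreal G"
  proof (rule nn_integral_on_exhaust)
    have pos: "0 < y / real (Suc (Suc n))" "y / real (Suc (Suc n)) < y" for n
    proof -
      show "0 < y / real (Suc (Suc n))" using y by simp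
      have "y * 1 < y * real (Suc (Suc n))" using y by (intro mult_strict_left_mono) auto
      then show "y / real (Suc (Suc n)) < y" by (simp add: pos_divide_less_eq)
    qed
    show "incseq ?A"
    proof (intro incseq_SucI)
      fix n
      have "y / real (Suc (Suc (Suc n))) \<le> y / real (Suc (Suc n))" using y by (intro divide_left_mono) auto
      then show "?A n \<subseteq> ?A (Suc n)" by auto
    qed
    fix n
    show "(\<lambda>x. ennreal (\<Psi> x)) \<in> borel_measurable (lebesgue_on (?A n))" using \<Psi>_meas[OF pos(1)] by simp
    show "(\<integral>\<^sup>+x. ennreal (\<Psi> x) \<partial>lebesgue_on (?A n)) \<le> ennreal G" by (rule bound[OF pos])
  qed auto
  finally show ?thesis unfolding G_eq[symmetric] unfolding G_def .
qed

end

section \<open>The two signs of the derivative of the weight exponent\<close>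

theorem proposition5p2:
  fixes M \<phi> \<omega> :: "real \<Rightarrow> real" and d\<^sub>M D\<^sub>M :: real
  assumes "N_function M"
    and "M differentiable_on {0..}"
    and "1 \<le> d\<^sub>M" and "d\<^sub>M \<le> D\<^sub>M"
    and "\<forall>x>0. d\<^sub>M * (M x / x) \<le> deriv M x \<and> deriv M x \<le> D\<^sub>M * (M x / x)"
    and "\<phi> C1_differentiable_on {0<..}"
    and "deriv \<phi> C1_differentiable_on {0<..}"
    and "\<forall>r>0. deriv \<phi> r \<noteq> 0"
    and "\<forall>r>0. 0 \<le> \<omega> r"
    and "\<omega> C1_differentiable_on {0<..}"
    and "\<forall>\<^sub>F r in at_right 0. A_phi M d\<^sub>M D\<^sub>M \<phi> r < \<infinity>"
    and "Bfun (K_fun M d\<^sub>M D\<^sub>M \<phi> \<omega>) (at_right 0)"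
    and "((\<forall>r>0. 0 < deriv \<phi> r) \<and> 0 < b1 d\<^sub>M D\<^sub>M \<phi> \<omega> \<and> L_const \<phi> \<omega> < \<infinity>) \<or>
         ((\<forall>r>0. deriv \<phi> r < 0) \<and> 0 < b2 d\<^sub>M D\<^sub>M \<phi> \<omega> \<and> L_const \<phi> \<omega> < \<infinity>)"
  shows "(\<exists>C>0. \<forall>u\<in>hardy_transforms.
            (\<integral>\<^sup>+x. ennreal (M (\<omega> x * \<bar>u x\<bar>) * exp (- \<phi> x)) \<partial>lebesgue_on {0<..})
            \<le> ennreal C * (\<integral>\<^sup>+x. ennreal (M \<bar>deriv u x\<bar> * exp (- \<phi> x)) \<partial>lebesgue_on {0<..}))
       \<and> (\<exists>B>0. \<forall>y>0. \<forall>\<epsilon>>0.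
            G_fun M \<phi> \<omega> \<epsilon> y < \<infinity> \<and>
            (\<integral>\<^sup>+x. ennreal (complementary M
                      (enn2real (G_fun M \<phi> \<omega> \<epsilon> y) / (B * \<epsilon> * exp (- \<phi> x))) * exp (- \<phi> x))
                \<partial>lebesgue_on {0<..<y})
            \<le> G_fun M \<phi> \<omega> \<epsilon> y)"
proof -
  have Lfin: "L_const \<phi> \<omega> < \<infinity>" using assms(13) by auto
  define L where "L = max 1 (real_of_ereal (L_const \<phi> \<omega>))"
  have omega_le: "\<omega> r \<le> L * \<bar>deriv \<phi> r\<bar>" if r: "0 < r" for r
  proof -
    have le: "ereal (\<omega> r / \<bar>deriv \<phi> r\<bar>) \<le> L_const \<phi> \<omega>"
      unfolding L_const_def by (rule SUP_upper) (use r in auto)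
    then have "\<omega> r / \<bar>deriv \<phi> r\<bar> \<le> real_of_ereal (L_const \<phi> \<omega>)"
      using Lfin by (cases "L_const \<phi> \<omega>") auto
    then have "\<omega> r / \<bar>deriv \<phi> r\<bar> \<le> L" by (simp add: L_def)
    then show ?thesis using assms(8) r by (simp add: pos_divide_le_eq)
  qed
  \<comment> \<open>the term subtracted in \<open>b\<^sub>1\<close> for \<open>(p, q) = (D, d)\<close>, and the term added in \<open>b\<^sub>2\<close> for \<open>(d, D)\<close>\<close>
  define sel where "sel = (\<lambda>r p q. deriv \<omega> r / (\<omega> r * deriv \<phi> r) * (p * indicator (F_set \<phi> \<omega>) r + q * indicator (G0_set \<phi> \<omega>) r))"
  have weights: "p * (deriv \<omega> r / (\<omega> r * deriv \<phi> r)) \<le> sel r D\<^sub>M d\<^sub>M"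
       "sel r d\<^sub>M D\<^sub>M \<le> p * (deriv \<omega> r / (\<omega> r * deriv \<phi> r))"
    if r: "0 < r" and p: "d\<^sub>M \<le> p" "p \<le> D\<^sub>M" for r p :: real
  proof -
    define z where "z = deriv \<omega> r / (\<omega> r * deriv \<phi> r)"
    have sel_eq: "sel r s t = z * (s * indicator (F_set \<phi> \<omega>) r + t * indicator (G0_set \<phi> \<omega>) r)" for s t
      by (simp add: sel_def z_def)
    have "p * z \<le> sel r D\<^sub>M d\<^sub>M \<and> sel r d\<^sub>M D\<^sub>M \<le> p * z"
    proof (cases "\<omega> r = 0")
      case True
      then show ?thesis by (simp add: sel_eq z_def)
    next
      case False
      then have om: "0 < \<omega> r" using assms(9) r by (metis less_eq_real_def)
      have z: "z = (deriv \<omega> r * deriv \<phi> r) / (\<omega> r * (deriv \<phi> r)\<^sup>2)"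
        using assms(8) r om by (simp add: z_def power2_eq_square)
      have pos: "0 < \<omega> r * (deriv \<phi> r)\<^sup>2" using om assms(8) r by simp
      consider "0 < deriv \<omega> r * deriv \<phi> r" | "deriv \<omega> r * deriv \<phi> r < 0" | "deriv \<omega> r * deriv \<phi> r = 0"
        by linarith
      then show ?thesis
      proof cases
        case 1
        then have "0 \<le> z" unfolding z using pos by (intro divide_nonneg_nonneg) auto
        moreover have "r \<in> F_set \<phi> \<omega>" "r \<notin> G0_set \<phi> \<omega>" using 1 r om by (auto simp: F_set_def G0_set_def)
        ultimately show ?thesis
          using mult_right_mono[OF p(1), of z] mult_right_mono[OF p(2), of z] by (simp add: sel_eq mult.commute)
      next
        case 2
        then have "z \<le> 0" unfolding z using pos by (intro divide_nonpos_nonneg) auto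
        moreover have "r \<notin> F_set \<phi> \<omega>" "r \<in> G0_set \<phi> \<omega>" using 2 r om by (auto simp: F_set_def G0_set_def)
        ultimately show ?thesis
          using mult_right_mono_neg[OF p(1), of z] mult_right_mono_neg[OF p(2), of z] by (simp add: sel_eq mult.commute)
      next
        case 3
        then have "z = 0" unfolding z by simp
        then show ?thesis by (simp add: sel_eq)
      qed
    qed
    then show "p * (deriv \<omega> r / (\<omega> r * deriv \<phi> r)) \<le> sel r D\<^sub>M d\<^sub>M"
       "sel r d\<^sub>M D\<^sub>M \<le> p * (deriv \<omega> r / (\<omega> r * deriv \<phi> r))" by (auto simp: z_def)
  qed
  obtain \<sigma> b where sb: "\<bar>\<sigma>\<bar> = 1" "\<And>r. 0 < r \<Longrightarrow> 0 < \<sigma> * deriv \<phi> r" "0 < b"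
     "\<And>r p. 0 < r \<Longrightarrow> d\<^sub>M \<le> p \<Longrightarrow> p \<le> D\<^sub>M \<Longrightarrow>
       b \<le> \<sigma> * (1 + deriv (deriv \<phi>) r / (deriv \<phi> r)\<^sup>2 - p * (deriv \<omega> r / (\<omega> r * deriv \<phi> r)))"
  proof -
    from assms(13) consider "\<forall>r>0. 0 < deriv \<phi> r" "0 < b1 d\<^sub>M D\<^sub>M \<phi> \<omega>"
      | "\<forall>r>0. deriv \<phi> r < 0" "0 < b2 d\<^sub>M D\<^sub>M \<phi> \<omega>" by blast
    then show thesis
    proof cases
      case 1
      obtain b where b: "0 < ereal b" "ereal b < b1 d\<^sub>M D\<^sub>M \<phi> \<omega>" using ereal_dense2[OF 1(2)] by blast
      show thesis
      proof (rule that[of 1 b])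
        fix r p :: real assume r: "0 < r" and p: "d\<^sub>M \<le> p" "p \<le> D\<^sub>M"
        have "b1 d\<^sub>M D\<^sub>M \<phi> \<omega> \<le> ereal (1 + deriv (deriv \<phi>) r / (deriv \<phi> r)\<^sup>2 - sel r D\<^sub>M d\<^sub>M)"
          unfolding b1_def sel_def by (rule INF_lower2[of r]) (use r in \<open>auto simp: add.commute\<close>)
        then have "ereal b \<le> ereal (1 + deriv (deriv \<phi>) r / (deriv \<phi> r)\<^sup>2 - sel r D\<^sub>M d\<^sub>M)"
          using b(2) by (meson less_imp_le order_trans)
        then show "b \<le> 1 * (1 + deriv (deriv \<phi>) r / (deriv \<phi> r)\<^sup>2 - p * (deriv \<omega> r / (\<omega> r * deriv \<phi> r)))"
          using weights(1)[OF r p] by simp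
      qed (use 1 b in auto)
    next
      case 2
      obtain b where b: "0 < ereal b" "ereal b < b2 d\<^sub>M D\<^sub>M \<phi> \<omega>" using ereal_dense2[OF 2(2)] by blast
      show thesis
      proof (rule that[of "- 1" b])
        fix r p :: real assume r: "0 < r" and p: "d\<^sub>M \<le> p" "p \<le> D\<^sub>M"
        have "b2 d\<^sub>M D\<^sub>M \<phi> \<omega> \<le> ereal (- 1 - deriv (deriv \<phi>) r / (deriv \<phi> r)\<^sup>2 + sel r d\<^sub>M D\<^sub>M)"
          unfolding b2_def sel_def by (rule INF_lower2[of r]) (use r in auto)
        then have "ereal b \<le> ereal (- 1 - deriv (deriv \<phi>) r / (deriv \<phi> r)\<^sup>2 + sel r d\<^sub>M D\<^sub>M)"
          using b(2) by (meson less_imp_le order_trans)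
        then show "b \<le> - 1 * (1 + deriv (deriv \<phi>) r / (deriv \<phi> r)\<^sup>2 - p * (deriv \<omega> r / (\<omega> r * deriv \<phi> r)))"
          using weights(2)[OF r p] by simp
      qed (use 2 b in auto)
    qed
  qed
  interpret weighted_hardy M d\<^sub>M D\<^sub>M \<phi> \<omega> \<sigma> b L
    by unfold_locales (use assms sb omega_le in \<open>auto simp: L_def\<close>)
  show ?thesis
  proof (intro conjI)
    show "\<exists>C>0. \<forall>u\<in>hardy_transforms.
            (\<integral>\<^sup>+x. ennreal (M (\<omega> x * \<bar>u x\<bar>) * exp (- \<phi> x)) \<partial>lebesgue_on {0<..})
            \<le> ennreal C * (\<integral>\<^sup>+x. ennreal (M \<bar>deriv u x\<bar> * exp (- \<phi> x)) \<partial>lebesgue_on {0<..})"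
    proof (intro exI[of _ hardy_const] conjI ballI hardy_const_pos)
      fix u assume u: "u \<in> hardy_transforms"
      have "(\<integral>\<^sup>+x. ennreal (M (\<omega> x * \<bar>u x\<bar>) * exp (- \<phi> x)) \<partial>lebesgue_on {0<..})
          = mod_integral (\<lambda>x. \<omega> x * u x) {0<..}"
        unfolding mod_integral_def using omega_nonneg
        by (intro nn_integral_cong) (simp add: space_restrict_space abs_mult)
      also have "\<dots> \<le> ennreal hardy_const * mod_integral (deriv u) {0<..}"
        unfolding hardy_const_def by (rule hardy_inequality[OF u])
      finally show "(\<integral>\<^sup>+x. ennreal (M (\<omega> x * \<bar>u x\<bar>) * exp (- \<phi> x)) \<partial>lebesgue_on {0<..})
            \<le> ennreal hardy_const * (\<integral>\<^sup>+x. ennreal (M \<bar>deriv u x\<bar> * exp (- \<phi> x)) \<partial>lebesgue_on {0<..})"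
        unfolding mod_integral_def .
    qed
    show "\<exists>B>0. \<forall>y>0. \<forall>\<epsilon>>0.
            G_fun M \<phi> \<omega> \<epsilon> y < \<infinity> \<and>
            (\<integral>\<^sup>+x. ennreal (complementary M
                      (enn2real (G_fun M \<phi> \<omega> \<epsilon> y) / (B * \<epsilon> * exp (- \<phi> x))) * exp (- \<phi> x))
                \<partial>lebesgue_on {0<..<y})
            \<le> G_fun M \<phi> \<omega> \<epsilon> y"
      using hardy_const_pos by (intro exI[of _ "1 + hardy_const"] conjI allI impI G_fun_finite dual_estimate refl) auto
  qed
qed

end
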